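(* Let $\bar x\in\mathbb{R}^n$. Suppose that $x^\nu\to\bar x$, that $\alpha^\nu,\beta^\nu>0$ with $\alpha^\nu\searrow0$, $\beta^\nu\searrow0$, and that $S(\bar x)=\{(\bar y,\bar p)\}$ where: (i) (basic qualification) $u\in\partial^\infty h(G(\bar x,\bar y))$ and $\nabla_yG(\bar x,\bar y)^\top u=0$ imply $u=0$; (ii) (relative interior condition) $G(\bar x,\bar y)\in\operatorname{ri}(\partial h^*(\bar p))$; (iii) (second-order condition) for all $w\in\mathbb{R}^m$ and $z\in K_{h^*}(\bar p,G(\bar x,\bar y))$, if $-\nabla_yG(\bar x,\bar y)^\top z=\nabla^2_{yy}L(\bar x,\bar y,\bar p)w$ and $-\nabla_yG(\bar x,\bar y)w\in K_{h^*}(\bar p,G(\bar x,\bar y))^\perp$, then $w=0$ and $z=0$. Then $S_{\alpha^\nu,\beta^\nu}(x^\nu)\to(\bar y,\bar p)$, $S_{\alpha^\nu,\beta^\nu}$ is $C^1$ around $x^\nu$ for all sufficiently large $\nu$, and $\nabla S_{\alpha^\nu,\beta^\nu}(x^\nu)\to\nabla S(\bar x)$.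
   Context: Standing assumptions: $g:\mathbb{R}^n\times\mathbb{R}^m\to\mathbb{R}$ and $G=(g_1,\dots,g_s):\mathbb{R}^n\times\mathbb{R}^m\to\mathbb{R}^s$ are $C^2$; for every $x\in\mathbb{R}^n$, $g(x,\cdot)$ and each $g_i(x,\cdot)$ are convex; $h:\mathbb{R}^s\to[-\infty,\infty]$ is proper, epi-polyhedral (its epigraph is a polyhedral set) and nondecreasing ($z\ge z'$ componentwise implies $h(z)\ge h(z')$). $h^*$ is the convex conjugate of $h$, $\partial h^*$ its subdifferential, $\operatorname{ri}$ the relative interior. For $\alpha,\beta>0$, $S_{\alpha,\beta}(x)$ is the set of $(y,p)\in\mathbb{R}^m\times\mathbb{R}^s$ with $0=-\nabla_yg(x,y)-\nabla_yG(x,y)^\top p-\beta y$ and $0\in -G(x,y)+\alpha p+\partial h^*(p)$; it is a singleton for every $x$, so $S_{\alpha,\beta}$ is treated as a function. $S(x)$ is the set of $(y,p)$ with $0=-\nabla_yg(x,y)-\nabla_yG(x,y)^\top p$ and $0\in-G(x,y)+\partial h^*(p)$. Under conditions (i)–(iii), $S$ is single-valued and $C^1$ around $\bar x$, so that $\nabla S(\bar x)$ is well defined. The Lagrangian is $L(x,y,p)=g(x,y)+\langle G(x,y),p\rangle-h^*(p)$. The horizon subdifferential is $\partial^\infty h(z)=\{u\mid(u,0)\in N_{\operatorname{epi}h}(z,h(z))\}$ for $z$ with $h(z)$ finite, $N$ denoting the normal cone. The critical cone of $h^*$ at $p$ for $u\in\partial h^*(p)$ is $K_{h^*}(p,u)=N_{\partial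 h^*(p)}(u)$. $\nabla_yG$, $\nabla S$, $\nabla S_{\alpha,\beta}$ are Jacobians. *)

theory Defs
  imports "HOL-Analysis.Analysis"
begin

section \<open>Extended-real convex analysis\<close>

definition proper_fun :: "('a \<Rightarrow> ereal) \<Rightarrow> bool" where
  "proper_fun h \<longleftrightarrow> (\<forall>z. h z \<noteq> -\<infinity>) \<and> (\<exists>z. h z \<noteq> \<infinity>)"

definition epi :: "('a \<Rightarrow> ereal) \<Rightarrow> ('a \<times> real) set" where
  "epi h = {(z, a). h z \<le> ereal a}"

definition convex_conjugate :: "('a::real_inner \<Rightarrow> ereal) \<Rightarrow> 'a \<Rightarrow> ereal" where
  "convex_conjugate h p = (SUP z. ereal (p \<bullet> z) - h z)"

(* As usual, the subdifferential is empty where the function is not finite. *)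
definition subdifferential :: "('a::real_inner \<Rightarrow> ereal) \<Rightarrow> 'a \<Rightarrow> 'a set" where
  "subdifferential f p =
     {v. \<bar>f p\<bar> \<noteq> \<infinity> \<and> (\<forall>q. f p + ereal (v \<bullet> (q - p)) \<le> f q)}"

(* The normal cone of convex analysis; it is only applied to convex sets below
   (the polyhedral set epi h and subdifferentials). *)
definition normal_cone :: "'a::real_inner set \<Rightarrow> 'a \<Rightarrow> 'a set" where
  "normal_cone C z = {v. z \<in> C \<and> (\<forall>z'\<in>C. v \<bullet> (z' - z) \<le> 0)}"

definition horizon_subdifferential :: "('a::real_inner \<Rightarrow> ereal) \<Rightarrow> 'a \<Rightarrow> 'a set" where
  "horizon_subdifferential h z =
     {u. \<bar>h z\<bar> \<noteq> \<infinity> \<and> (u, 0) \<in> normal_cone (epi h) (z, real_of_ereal (h z))}"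

definition critical_cone :: "('a::real_inner \<Rightarrow> ereal) \<Rightarrow> 'a \<Rightarrow> 'a \<Rightarrow> 'a set" where
  "critical_cone f p u = normal_cone (subdifferential f p) u"


section \<open>Derivatives and smoothness\<close>

(* The Jacobian as a bounded linear map; needed for maps whose domain or range is a product
   or an operator space, where the matrix-valued jacobian of the library does not apply. *)
definition total_deriv ::
  "('a::real_normed_vector \<Rightarrow> 'b::real_normed_vector) \<Rightarrow> 'a \<Rightarrow> 'a \<Rightarrow>\<^sub>L 'b" where
  "total_deriv f x = Blinfun (frechet_derivative f (at x))"

definition C1_on :: "'a::real_normed_vector set \<Rightarrow> ('a \<Rightarrow> 'b::real_normed_vector) \<Rightarrow> bool" where
  "C1_on U f \<longleftrightarrow> (\<forall>x\<in>U. f differentiable at x) \<and> continuous_on U (total_deriv f)"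

definition C2_on :: "'a::real_normed_vector set \<Rightarrow> ('a \<Rightarrow> 'b::real_normed_vector) \<Rightarrow> bool" where
  "C2_on U f \<longleftrightarrow> C1_on U f \<and> C1_on U (total_deriv f)"

definition grad :: "('a::real_inner \<Rightarrow> real) \<Rightarrow> 'a \<Rightarrow> 'a" where
  "grad f y = (THE d. GDERIV f y :> d)"

definition hessian :: "(real^'m \<Rightarrow> real) \<Rightarrow> real^'m \<Rightarrow> real^'m^'m" where
  "hessian f y = jacobian (grad f) (at y)"

(* A set-valued mapping is identified with a function where its values are singletons. *)
definition as_fun :: "('a \<Rightarrow> 'b set) \<Rightarrow> 'a \<Rightarrow> 'b" where
  "as_fun F x = the_elem (F x)"

definition single_valued_C1_around ::
  "('a::real_normed_vector \<Rightarrow> 'b::real_normed_vector set) \<Rightarrow> 'a \<Rightarrow> bool" where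
  "single_valued_C1_around F x \<longleftrightarrow>
     (\<exists>U. open U \<and> x \<in> U \<and> (\<forall>x'\<in>U. is_singleton (F x')) \<and> C1_on U (as_fun F))"


section \<open>The parametric composite problem\<close>

definition grad_y :: "('x \<times> (real^'m) \<Rightarrow> real) \<Rightarrow> 'x \<Rightarrow> real^'m \<Rightarrow> real^'m" where
  "grad_y g x y = grad (\<lambda>y'. g (x, y')) y"

definition jac_y :: "('x \<times> (real^'m) \<Rightarrow> real^'s) \<Rightarrow> 'x \<Rightarrow> real^'m \<Rightarrow> real^'m^'s" where
  "jac_y G x y = jacobian (\<lambda>y'. G (x, y')) (at y)"

definition lagrangian ::
  "('x \<times> (real^'m) \<Rightarrow> real) \<Rightarrow> ('x \<times> (real^'m) \<Rightarrow> real^'s) \<Rightarrow> (real^'s \<Rightarrow> ereal)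
     \<Rightarrow> 'x \<Rightarrow> real^'m \<Rightarrow> real^'s \<Rightarrow> ereal" where
  "lagrangian g G h x y p = ereal (g (x, y) + G (x, y) \<bullet> p) - convex_conjugate h p"

(* The Lagrangian is finite in y whenever p lies in the domain of the conjugate, which
   holds for every p occurring in a solution of the optimality system. *)
definition hess_yy_lagrangian ::
  "('x \<times> (real^'m) \<Rightarrow> real) \<Rightarrow> ('x \<times> (real^'m) \<Rightarrow> real^'s) \<Rightarrow> (real^'s \<Rightarrow> ereal)
     \<Rightarrow> 'x \<Rightarrow> real^'m \<Rightarrow> real^'s \<Rightarrow> real^'m^'m" where
  "hess_yy_lagrangian g G h x y p =
     hessian (\<lambda>y'. real_of_ereal (lagrangian g G h x y' p)) y"

definition sol_reg ::
  "('x \<times> (real^'m) \<Rightarrow> real) \<Rightarrow> ('x \<times> (real^'m) \<Rightarrow> real^'s) \<Rightarrow> (real^'s \<Rightarrow> ereal)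
     \<Rightarrow> real \<Rightarrow> real \<Rightarrow> 'x \<Rightarrow> ((real^'m) \<times> (real^'s)) set" where
  "sol_reg g G h \<alpha> \<beta> x =
     {(y, p). 0 = - grad_y g x y - transpose (jac_y G x y) *v p - \<beta> *\<^sub>R y \<and>
              0 \<in> (\<lambda>v. - G (x, y) + \<alpha> *\<^sub>R p + v) ` subdifferential (convex_conjugate h) p}"

definition sol ::
  "('x \<times> (real^'m) \<Rightarrow> real) \<Rightarrow> ('x \<times> (real^'m) \<Rightarrow> real^'s) \<Rightarrow> (real^'s \<Rightarrow> ereal)
     \<Rightarrow> 'x \<Rightarrow> ((real^'m) \<times> (real^'s)) set" where
  "sol g G h x =
     {(y, p). 0 = - grad_y g x y - transpose (jac_y G x y) *v p \<and>
              0 \<in> (\<lambda>v. - G (x, y) + v) ` subdifferential (convex_conjugate h) p}"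

end

theory Submission
  imports Defs
begin

text \<open>By the relative interior condition, the critical cone is a subspace \<open>K\<close>, and since \<open>h\<close> is
  polyhedral, every \<open>(p, u)\<close> close to \<open>(pbar, ubar)\<close>, \<open>ubar = G (xbar, ybar)\<close>, with \<open>p - pbar \<in> K\<close>
  and \<open>u - ubar\<close> orthogonal to \<open>K\<close> lies on the graph of the subdifferential of the conjugate.
  Replacing the graph by this affine space turns the optimality systems into smooth equations depending on
  \<open>(x, \<alpha>, \<beta>)\<close>, and the second-order condition says that the derivative in \<open>(y, p)\<close> is
  injective. The implicit function theorem then yields one branch, continuously differentiable up to
  \<open>\<alpha> = \<beta> = 0\<close>, of local solutions. That the branch exhausts the solution sets follows from
  monotonicity of the system: it is strong for \<open>\<alpha>, \<beta> > 0\<close>, and the unregularized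
  system is reached by adding small regularization terms centred at a given solution.\<close>

section \<open>Continuously differentiable maps\<close>

lemma total_deriv_eq:
  assumes "(f has_derivative blinfun_apply f') (at x)"
  shows "total_deriv f x = f'"
  by (simp add: total_deriv_def blinfun_apply_inverse flip: frechet_derivative_at[OF assms])

lemma has_derivative_total_deriv:
  assumes "f differentiable at x"
  shows "(f has_derivative blinfun_apply (total_deriv f x)) (at x)"
proof -
  have "(f has_derivative frechet_derivative f (at x)) (at x)"
    using assms by (simp add: frechet_derivative_works)
  then show ?thesis
    by (simp add: total_deriv_def bounded_linear_Blinfun_apply has_derivative_bounded_linear)
qed

lemma C1_on_has_derivative:
  assumes "C1_on U f" "x \<in> U"
  shows "(f has_derivative blinfun_apply (total_deriv f x)) (at x)"
  using assms by (auto simp: C1_on_def intro: has_derivative_total_deriv)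

lemma C1_onI:
  assumes deriv: "\<And>x. x \<in> U \<Longrightarrow> (f has_derivative blinfun_apply (f' x)) (at x)"
    and cont: "continuous_on U f'"
  shows "C1_on U f"
proof -
  have "continuous_on U (total_deriv f) = continuous_on U f'"
    by (rule continuous_on_cong) (auto intro: total_deriv_eq deriv)
  then show ?thesis
    using cont deriv by (auto simp: C1_on_def differentiable_def)
qed

lemma C1_on_imp_continuous_on: "C1_on U f \<Longrightarrow> continuous_on U f"
  by (meson C1_on_def continuous_at_imp_continuous_on differentiable_imp_continuous_within)

lemma C1_on_const: "C1_on U (\<lambda>x. c)"
  by (rule C1_onI[where f' = "\<lambda>x. 0"]) (auto simp: zero_blinfun.rep_eq)

lemma C1_on_bounded_linear:
  assumes "bounded_linear L" shows "C1_on U L"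
  by (rule C1_onI[where f' = "\<lambda>x. Blinfun L"])
    (auto simp: bounded_linear_Blinfun_apply assms intro: bounded_linear_imp_has_derivative)

lemma C1_on_subset: "C1_on V f \<Longrightarrow> U \<subseteq> V \<Longrightarrow> C1_on U f"
  by (auto simp: C1_on_def intro: continuous_on_subset)

lemma C1_on_compose:
  assumes f: "C1_on V f" and g: "C1_on U g" and sub: "g ` U \<subseteq> V"
  shows "C1_on U (\<lambda>x. f (g x))"
proof (rule C1_onI[where f' = "\<lambda>x. total_deriv f (g x) o\<^sub>L total_deriv g x"])
  fix x assume x: "x \<in> U"
  then show "((\<lambda>x. f (g x)) has_derivative blinfun_apply (total_deriv f (g x) o\<^sub>L total_deriv g x)) (at x)"
    using diff_chain_at[OF C1_on_has_derivative[OF g x] C1_on_has_derivative[OF f]] sub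
    by (simp add: o_def blinfun_compose.rep_eq image_subset_iff)
next
  have "continuous_on U (\<lambda>x. total_deriv f (g x))"
    using f C1_on_imp_continuous_on[OF g] sub
    by (auto simp: C1_on_def intro: continuous_on_compose2)
  then show "continuous_on U (\<lambda>x. total_deriv f (g x) o\<^sub>L total_deriv g x)"
    using g by (auto simp: C1_on_def intro: continuous_intros)
qed

lemma C1_on_linear_compose:
  assumes "bounded_linear L" "C1_on U f" shows "C1_on U (\<lambda>x. L (f x))"
  using C1_on_compose[OF C1_on_bounded_linear[OF assms(1), of UNIV] assms(2)] by simp

lemma C1_on_ident: "C1_on U (\<lambda>x. x)"
  by (rule C1_on_bounded_linear[OF bounded_linear_ident])

lemmas C1_on_fst = C1_on_linear_compose[OF bounded_linear_fst]
lemmas C1_on_snd = C1_on_linear_compose[OF bounded_linear_snd]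

lemma C1_on_add:
  assumes f: "C1_on U f" and g: "C1_on U g"
  shows "C1_on U (\<lambda>x. f x + g x)"
proof (rule C1_onI[where f' = "\<lambda>x. total_deriv f x + total_deriv g x"])
  fix x assume x: "x \<in> U"
  show "((\<lambda>x. f x + g x) has_derivative blinfun_apply (total_deriv f x + total_deriv g x)) (at x)"
    using has_derivative_add[OF C1_on_has_derivative[OF f x] C1_on_has_derivative[OF g x]]
    by (simp add: plus_blinfun.rep_eq)
qed (use assms in \<open>auto simp: C1_on_def intro: continuous_intros\<close>)

lemma C1_on_diff:
  assumes "C1_on U f" "C1_on U g" shows "C1_on U (\<lambda>x. f x - g x)"
  using C1_on_add[OF assms(1) C1_on_linear_compose[OF bounded_linear_minus[OF bounded_linear_ident] assms(2)]]
  by simp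

lemma C1_on_Pair:
  assumes "C1_on U f" "C1_on U g" shows "C1_on U (\<lambda>x. (f x, g x))"
proof -
  have "C1_on U (\<lambda>x. (f x, 0) + (0, g x))"
    by (intro C1_on_add C1_on_linear_compose[of "\<lambda>u. (u, 0)"] C1_on_linear_compose[of "\<lambda>u. (0, u)"]
        assms bounded_linear_Pair bounded_linear_ident bounded_linear_zero)
  then show ?thesis by simp
qed

lemma (in bounded_bilinear) C1_on_bilinear:
  assumes f: "C1_on U f" and g: "C1_on U g"
  shows "C1_on U (\<lambda>x. prod (f x) (g x))"
proof (rule C1_onI[where f' = "\<lambda>x. (prod_right (f x) o\<^sub>L total_deriv g x) + (prod_left (g x) o\<^sub>L total_deriv f x)"])
  fix x assume x: "x \<in> U"
  show "((\<lambda>x. prod (f x) (g x)) has_derivative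
      blinfun_apply ((prod_right (f x) o\<^sub>L total_deriv g x) + (prod_left (g x) o\<^sub>L total_deriv f x))) (at x)"
    using FDERIV[OF C1_on_has_derivative[OF f x] C1_on_has_derivative[OF g x]]
    by (simp add: plus_blinfun.rep_eq blinfun_compose.rep_eq o_def)
next
  show "continuous_on U (\<lambda>x. (prod_right (f x) o\<^sub>L total_deriv g x) + (prod_left (g x) o\<^sub>L total_deriv f x))"
    using f g C1_on_imp_continuous_on[OF f] C1_on_imp_continuous_on[OF g]
    by (auto simp: C1_on_def intro!: continuous_intros
        bounded_linear.continuous_on[OF bounded_linear_prod_left]
        bounded_linear.continuous_on[OF bounded_linear_prod_right])
qed

text \<open>Transfers smoothness from a branch in all parameters to the solution map in
  \<open>x\<close> alone. The chain rule along \<open>x \<mapsto> (x, c)\<close> gives the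
  derivative as \<open>total_deriv \<sigma> (x, c)\<close> followed by a fixed embedding, whatever
  \<open>c\<close> is, so derivatives of sections with different \<open>c\<close> can be compared
  through continuity of \<open>total_deriv \<sigma>\<close>.\<close>

lemma C1_section:
  fixes \<sigma> :: "'a::real_normed_vector \<times> 'b::real_normed_vector \<Rightarrow> 'c::real_normed_vector"
  assumes W: "open W" and \<sigma>: "C1_on W \<sigma>" and x0: "(x0, c) \<in> W"
    and eq: "\<And>x. (x, c) \<in> W \<Longrightarrow> \<Phi> x = {\<sigma> (x, c)}"
  shows "single_valued_C1_around \<Phi> x0"
    and "total_deriv (as_fun \<Phi>) x0 = total_deriv \<sigma> (x0, c) o\<^sub>L Blinfun (\<lambda>x. (x, 0))"
proof -
  define U where "U = (\<lambda>x. (x, c)) -` W"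
  have U: "open U" unfolding U_def by (intro open_vimage W continuous_intros)
  have bl: "bounded_linear (\<lambda>x::'a. (x, 0::'b))"
    by (intro bounded_linear_Pair bounded_linear_ident bounded_linear_zero)
  have deriv: "(as_fun \<Phi> has_derivative blinfun_apply (total_deriv \<sigma> (x, c) o\<^sub>L Blinfun (\<lambda>x. (x, 0)))) (at x)"
    if x: "x \<in> U" for x
  proof (rule has_derivative_transform_within_open[OF _ U x])
    have "((\<lambda>x. (x, c)) has_derivative (\<lambda>x. (x, 0))) (at x)"
      by (intro derivative_intros)
    moreover have "(\<sigma> has_derivative blinfun_apply (total_deriv \<sigma> (x, c))) (at (x, c))"
      using x by (intro C1_on_has_derivative[OF \<sigma>]) (simp add: U_def)
    ultimately show "((\<lambda>x. \<sigma> (x, c)) has_derivative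
        blinfun_apply (total_deriv \<sigma> (x, c) o\<^sub>L Blinfun (\<lambda>x. (x, 0)))) (at x)"
      using diff_chain_at by (fastforce simp: o_def blinfun_compose.rep_eq bounded_linear_Blinfun_apply[OF bl])
    show "\<sigma> (x', c) = as_fun \<Phi> x'" if "x' \<in> U" for x'
      using eq[of x'] that by (simp add: U_def as_fun_def)
  qed
  have "continuous_on W (total_deriv \<sigma>)" using \<sigma> by (simp add: C1_on_def)
  moreover have "continuous_on U (\<lambda>x. (x, c))" by (intro continuous_intros)
  ultimately have "continuous_on U (\<lambda>x. total_deriv \<sigma> (x, c))"
    by (rule continuous_on_compose2) (auto simp: U_def)
  then have "C1_on U (as_fun \<Phi>)"
    by (intro C1_onI[OF deriv] continuous_intros)
  moreover have "x0 \<in> U" using x0 by (simp add: U_def)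
  moreover have "\<forall>x\<in>U. is_singleton (\<Phi> x)"
    using eq by (simp add: U_def is_singleton_def)
  ultimately show "single_valued_C1_around \<Phi> x0"
    using U unfolding single_valued_C1_around_def by blast
  show "total_deriv (as_fun \<Phi>) x0 = total_deriv \<sigma> (x0, c) o\<^sub>L Blinfun (\<lambda>x. (x, 0))"
    by (rule total_deriv_eq[OF deriv[OF \<open>x0 \<in> U\<close>]])
qed

section \<open>Continuity of operator inversion and the implicit function theorem\<close>

lemma continuous_on_blinfun_inverse:
  fixes A :: "'a::topological_space \<Rightarrow> ('b::real_normed_vector \<Rightarrow>\<^sub>L 'c::real_normed_vector)"
  assumes A: "continuous_on U A"
    and BA: "\<And>x. x \<in> U \<Longrightarrow> B x o\<^sub>L A x = id_blinfun"
    and AB: "\<And>x. x \<in> U \<Longrightarrow> A x o\<^sub>L B x = id_blinfun"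
  shows "continuous_on U B"
  unfolding continuous_on_def
proof
  fix x0 assume x0: "x0 \<in> U"
  let ?F = "at x0 within U" and ?c = "norm (B x0)"
  have lim: "((\<lambda>x. norm (A x0 - A x)) \<longlongrightarrow> 0) ?F"
    using tendsto_norm[OF tendsto_diff[OF tendsto_const, of A "A x0" ?F "A x0"]] A x0
    by (simp add: continuous_on_def)
  then have lim2: "((\<lambda>x. norm (A x0 - A x) * ?c) \<longlongrightarrow> 0) ?F"
    by (auto intro: tendsto_eq_intros)
  have small: "\<forall>\<^sub>F x in ?F. norm (A x0 - A x) * ?c < 1/2"
    using order_tendstoD(2)[OF lim2, of "1/2"] by simp
  have inU: "\<forall>\<^sub>F x in ?F. x \<in> U"
    by (simp add: eventually_at_filter)
  \<comment> \<open>The resolvent identity \<open>B x - B x0 = B x o (A x0 - A x) o B x0\<close>.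
    Where the last two factors contribute less than 1/2, it first bounds \<open>norm (B x)\<close>
    by twice \<open>norm (B x0)\<close>; inserted again, this makes the difference small.\<close>
  have bound: "norm (B x - B x0) \<le> 2 * ?c * (norm (A x0 - A x) * ?c)"
    if x: "x \<in> U" and s: "norm (A x0 - A x) * ?c < 1/2" for x
  proof -
    have "blinfun_apply (B x - B x0) v = blinfun_apply (B x o\<^sub>L ((A x0 - A x) o\<^sub>L B x0)) v" for v
    proof -
      have "B x (A x (B x0 v)) = B x0 v" "A x0 (B x0 v) = v"
        using BA[OF x] AB[OF x0] by (metis blinfun_apply_blinfun_compose blinfun_apply_id_blinfun)+
      then show ?thesis
        by (simp add: blinfun.bilinear_simps)
    qed
    then have "B x - B x0 = B x o\<^sub>L ((A x0 - A x) o\<^sub>L B x0)"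
      by (rule blinfun_eqI)
    then have le: "norm (B x - B x0) \<le> norm (B x) * (norm (A x0 - A x) * ?c)"
      by (smt (verit) mult_left_mono norm_blinfun_compose norm_ge_zero)
    have "norm (B x) \<le> ?c + norm (B x - B x0)"
      by (rule norm_triangle_sub)
    also have "\<dots> \<le> ?c + norm (B x) * (1/2)"
      using le s by (smt (verit) mult_left_mono norm_ge_zero)
    finally have "norm (B x) \<le> 2 * ?c" by simp
    then show ?thesis
      using le by (smt (verit) mult_right_mono norm_ge_zero mult_nonneg_nonneg)
  qed
  have "((\<lambda>x. B x - B x0) \<longlongrightarrow> 0) ?F"
  proof (rule Lim_null_comparison)
    show "\<forall>\<^sub>F x in ?F. norm (B x - B x0) \<le> 2 * ?c * (norm (A x0 - A x) * ?c)"
      using small inU by eventually_elim (rule bound)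
    show "((\<lambda>x. 2 * ?c * (norm (A x0 - A x) * ?c)) \<longlongrightarrow> 0) ?F"
      using tendsto_mult_right_zero[OF lim2] .
  qed
  then show "(B \<longlongrightarrow> B x0) ?F"
    by (simp add: LIM_zero_iff)
qed

text \<open>The inverse function theorem is applied to \<open>f (t, v) = (t, F (t, v))\<close>. The
  derivative of \<open>f\<close> is injective because the partial derivative of \<open>F\<close> in
  \<open>v\<close> is, and in finite dimension that suffices. The branch is the second component of
  the local inverse along the slice \<open>(t, 0)\<close>; it is C1 because the derivative of the
  local inverse is the inverse of a continuous family of operators.\<close>

lemma implicit_function:
  fixes F :: "'a::euclidean_space \<times> 'b::euclidean_space \<Rightarrow> 'b"
  assumes F: "C1_on UNIV F" and zero: "F (t0, v0) = 0"
    and inj: "\<And>v. total_deriv F (t0, v0) (0, v) = 0 \<Longrightarrow> v = 0"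
  obtains W \<sigma> where "open W" "t0 \<in> W" "\<sigma> t0 = v0" "C1_on W \<sigma>" "\<And>t. t \<in> W \<Longrightarrow> F (t, \<sigma> t) = 0"
proof -
  define f where "f z = (fst z, F z)" for z
  have fC1: "C1_on UNIV f"
    unfolding f_def by (intro C1_on_Pair F C1_on_bounded_linear bounded_linear_fst)
  then have derf: "(f has_derivative blinfun_apply (total_deriv f z)) (at z)"
    and contf: "continuous_on UNIV (total_deriv f)" for z
    using C1_on_has_derivative[OF fC1] fC1 by (simp_all add: C1_on_def)
  have f': "blinfun_apply (total_deriv f z) = (\<lambda>h. (fst h, total_deriv F z h))" for z
    unfolding f_def
    by (rule has_derivative_unique[OF derf[unfolded f_def]])
      (intro has_derivative_Pair C1_on_has_derivative[OF F]
        bounded_linear_imp_has_derivative bounded_linear_fst UNIV_I)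
  let ?D = "total_deriv f (t0, v0)"
  have linD: "linear (blinfun_apply ?D)"
    by (simp add: blinfun.bounded_linear_right bounded_linear.linear)
  have "inj (blinfun_apply ?D)"
  proof (subst linear_injective_0[OF linD], safe)
    fix a b assume "blinfun_apply ?D (a, b) = 0"
    then have "a = 0" "total_deriv F (t0, v0) (a, b) = 0"
      by (auto simp: f' zero_prod_def)
    then show "(a, b) = 0" using inj by (auto simp: zero_prod_def)
  qed
  then obtain inv' where inv': "linear inv'" "inv' \<circ> blinfun_apply ?D = id"
    using linear_injective_left_inverse[OF linD] by blast
  then have "Blinfun inv' o\<^sub>L ?D = id_blinfun"
    by (intro blinfun_eqI) (auto simp: bounded_linear_Blinfun_apply linear_conv_bounded_linear fun_eq_iff)
  then obtain U V g g' where V: "open V" "f (t0, v0) \<in> V" "(t0, v0) \<in> U"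
    and hom: "homeomorphism U V f g"
    and derg: "\<And>y. y \<in> V \<Longrightarrow> (g has_derivative (g' y)) (at y)"
    and g': "\<And>y. y \<in> V \<Longrightarrow> g' y = inv (blinfun_apply (total_deriv f (g y)))"
    and bij: "\<And>y. y \<in> V \<Longrightarrow> bij (blinfun_apply (total_deriv f (g y)))"
    using inverse_function_theorem[OF open_UNIV derf contf UNIV_I] by metis
  have lin': "blinfun_apply (Blinfun (g' y)) = g' y" if "y \<in> V" for y
    using derg[OF that] by (simp add: bounded_linear_Blinfun_apply has_derivative_bounded_linear)
  have "C1_on V g"
  proof (rule C1_onI[where f' = "\<lambda>y. Blinfun (g' y)"])
    show "continuous_on V (\<lambda>y. Blinfun (g' y))"
    proof (rule continuous_on_blinfun_inverse)
      show "continuous_on V (\<lambda>y. total_deriv f (g y))"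
        using hom by (intro continuous_on_compose2[OF contf]) (auto simp: homeomorphism_def)
    next
      fix y assume y: "y \<in> V"
      show "Blinfun (g' y) o\<^sub>L total_deriv f (g y) = id_blinfun"
        by (rule blinfun_eqI) (simp only: blinfun_apply_blinfun_compose blinfun_apply_id_blinfun
            trans[OF lin'[OF y] g'[OF y]] inv_f_f[OF bij_is_inj[OF bij[OF y]]])
      show "total_deriv f (g y) o\<^sub>L Blinfun (g' y) = id_blinfun"
        by (rule blinfun_eqI) (simp only: blinfun_apply_blinfun_compose blinfun_apply_id_blinfun
            trans[OF lin'[OF y] g'[OF y]] surj_f_inv_f[OF bij_is_surj[OF bij[OF y]]])
    qed
  qed (simp only: lin' derg)
  have inv_f: "f (g y) = y" if "y \<in> V" for y
    by (rule homeomorphism_apply2[OF hom that])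
  define W where "W = {t. (t, 0) \<in> V}"
  define \<sigma> where "\<sigma> t = snd (g (t, 0))" for t
  have f0: "f (t0, v0) = (t0, 0)" by (simp only: f_def zero fst_conv)
  show thesis
  proof (rule that)
    have "open ((\<lambda>t. (t, 0::'b)) -` V)"
      by (intro open_vimage V(1) continuous_intros)
    then show "open W" by (simp only: W_def vimage_def)
    show "t0 \<in> W" using V(2) by (simp only: W_def f0 mem_Collect_eq)
    show "\<sigma> t0 = v0"
      using homeomorphism_apply1[OF hom V(3)] by (simp only: f0 \<sigma>_def snd_conv)
    have sub: "(\<lambda>t. (t, 0)) ` W \<subseteq> V" by (simp add: W_def image_subset_iff)
    show "C1_on W \<sigma>"
      unfolding \<sigma>_def
      by (rule C1_on_linear_compose[OF bounded_linear_snd C1_on_compose[OF \<open>C1_on V g\<close> _ sub]])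
        (intro C1_on_bounded_linear bounded_linear_Pair bounded_linear_ident bounded_linear_zero)
    show "F (t, \<sigma> t) = 0" if "t \<in> W" for t
    proof -
      have "f (g (t, 0)) = (t, 0)" using that by (intro inv_f) (simp only: W_def mem_Collect_eq)
      then have "fst (g (t, 0)) = t" "F (g (t, 0)) = 0" by (simp_all only: f_def prod.inject)
      then show ?thesis by (metis \<sigma>_def prod.collapse)
    qed
  qed
qed

section \<open>Conjugates of polyhedral functions\<close>

lemma conjugate_upper: "ereal (p \<bullet> z) - h z \<le> convex_conjugate h p"
  unfolding convex_conjugate_def by (rule SUP_upper) simp

text \<open>Passing to real points of the epigraph turns a bound on the conjugate into linear
  inequalities, the form in which hyperplanes and polyhedrality can be used.\<close>

lemma conjugate_le_iff:
  assumes "\<And>z. h z \<noteq> -\<infinity>"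
  shows "convex_conjugate h p \<le> ereal c \<longleftrightarrow> (\<forall>(z, a)\<in>epi h. p \<bullet> z - a \<le> c)"
proof -
  have "(ereal (p \<bullet> z) - h z \<le> ereal c) \<longleftrightarrow> (\<forall>a. h z \<le> ereal a \<longrightarrow> p \<bullet> z - a \<le> c)" for z
    using assms[of z] by (cases "h z") (auto dest: order_trans[rotated] intro: add_left_mono)
  then show ?thesis
    by (auto simp: convex_conjugate_def SUP_le_iff epi_def)
qed

lemma conjugate_not_minus_infinity:
  assumes "proper_fun h" shows "convex_conjugate h p \<noteq> -\<infinity>"
proof -
  obtain z where z: "h z \<noteq> \<infinity>" "h z \<noteq> -\<infinity>" using assms by (auto simp: proper_fun_def)
  then show ?thesis using conjugate_upper[of p z h] by (cases "h z") auto
qed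

lemma subdifferential_real:
  assumes "u \<in> subdifferential f p"
  obtains c where "f p = ereal c" "\<And>q. ereal (c + u \<bullet> (q - p)) \<le> f q"
  using assms by (cases "f p") (auto simp: subdifferential_def)

text \<open>Equality in the Fenchel-Young inequality. One direction is the inequality itself. For
  the other, if \<open>(u, p \<bullet> u - c)\<close> were outside the closed convex epigraph, a
  separating hyperplane would yield a point at which the conjugate is too small for \<open>u\<close>
  to be a subgradient at \<open>p\<close>.\<close>

lemma subdifferential_conjugate_value:
  fixes h :: "'a::euclidean_space \<Rightarrow> ereal"
  assumes h: "proper_fun h" and cl: "closed (epi h)" and cv: "convex (epi h)"
    and u: "u \<in> subdifferential (convex_conjugate h) p" and c: "convex_conjugate h p = ereal c"
  shows "h u = ereal (p \<bullet> u - c)"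
proof (rule antisym)
  have fin: "\<And>z. h z \<noteq> -\<infinity>" using h by (auto simp: proper_fun_def)
  have sub: "ereal (c + u \<bullet> (q - p)) \<le> convex_conjugate h q" for q
    using u c by (auto simp: subdifferential_def)
  have c_ge: "p \<bullet> z - a \<le> c" if "(z, a) \<in> epi h" for z a
    using that conjugate_le_iff[where h = h, OF fin, of p c] c by auto
  show "ereal (p \<bullet> u - c) \<le> h u"
    using conjugate_upper[of p u h] fin[of u] c by (cases "h u") auto
  show "h u \<le> ereal (p \<bullet> u - c)"
  proof (rule ccontr)
    assume "\<not> h u \<le> ereal (p \<bullet> u - c)"
    then have "(u, p \<bullet> u - c) \<notin> epi h" by (simp add: epi_def)
    from separating_hyperplane_closed_point[OF cv cl this]
    obtain d b where less: "d \<bullet> (u, p \<bullet> u - c) < b" and gr: "\<forall>e\<in>epi h. b < d \<bullet> e" by blast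
    obtain q r where d: "d = (q, r)" by (cases d)
    have less: "q \<bullet> u + r * (p \<bullet> u - c) < b" using less by (simp add: d)
    have gr: "b < q \<bullet> z + r * a" if "(z, a) \<in> epi h" for z a using gr that by (auto simp: d)
    obtain z0 a0 where z0: "(z0, a0) \<in> epi h"
      using h by (auto simp: proper_fun_def epi_def) (metis ereal_less_eq(2) ereal_cases order_refl)
    \<comment> \<open>The epigraph is unbounded upwards: with \<open>r < 0\<close>, raising the last
      coordinate to the chosen \<open>a\<close> would bring the functional down to \<open>b\<close>
      or below.\<close>
    have "0 \<le> r"
    proof (rule ccontr)
      assume r: "\<not> 0 \<le> r"
      define a where "a = max a0 ((b - q \<bullet> z0) / r)"
      have "(z0, a) \<in> epi h"
        using z0 by (auto simp: epi_def a_def intro: order_trans)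
      then have "b < q \<bullet> z0 + r * a" by (rule gr)
      moreover have "r * a \<le> r * ((b - q \<bullet> z0) / r)"
        using r by (intro mult_left_mono_neg) (auto simp: a_def)
      ultimately show False using r by simp
    qed
    then consider "r = 0" | "r > 0" by linarith
    then show False
    proof cases
      case 1
      \<comment> \<open>Vertical hyperplane: the step from \<open>p\<close> to \<open>p - q\<close>
        lowers the conjugate by at least \<open>b\<close>, while the subgradient \<open>u\<close>
        allows a decrease of at most \<open>q \<bullet> u < b\<close>.\<close>
      have "convex_conjugate h (p - q) \<le> ereal (c - b)"
        unfolding conjugate_le_iff[where h = h, OF fin]
        using c_ge gr 1 by (force simp: inner_diff_left)
      then have "c + u \<bullet> (p - q - p) \<le> c - b"
        using sub[of "p - q"] by (metis ereal_less_eq(3) order_trans)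
      then show False using less 1 by (simp add: inner_commute)
    next
      case 2
      \<comment> \<open>Non-vertical hyperplane: solved for the last coordinate it is the graph of
        an affine minorant of \<open>h\<close> with slope \<open>q'\<close> and constant
        \<open>b / r\<close>.\<close>
      define q' where "q' = - (1 / r) *\<^sub>R q"
      have "q' \<bullet> z - a \<le> - (b / r)" if "(z, a) \<in> epi h" for z a
      proof -
        have "q' \<bullet> z - a = - ((q \<bullet> z + r * a) / r)" using 2 by (simp add: q'_def field_simps)
        then show ?thesis using gr[OF that] 2 by (simp add: divide_right_mono)
      qed
      then have "convex_conjugate h q' \<le> ereal (- (b / r))"
        unfolding conjugate_le_iff[where h = h, OF fin] by auto
      then have "c + u \<bullet> (q' - p) \<le> - (b / r)"
        using sub[of q'] by (metis ereal_less_eq(3) order_trans)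
      then have "r * (c + u \<bullet> (q' - p)) \<le> r * - (b / r)"
        using 2 by (simp only: mult_le_cancel_left_pos)
      moreover have "r * (c + u \<bullet> (q' - p)) = r * (c - p \<bullet> u) - q \<bullet> u"
        using 2 by (simp add: q'_def inner_diff_right inner_commute algebra_simps)
      ultimately show False using less 2 by (simp add: algebra_simps)
    qed
  qed
qed

text \<open>With the preceding lemma this identifies the subgradients of the conjugate at
  \<open>p\<close> as the points whose epigraph point lies on the supporting hyperplane with normal
  \<open>(p, -1)\<close>.\<close>

lemma subdifferential_conjugateI:
  assumes h: "proper_fun h" and hu: "h u \<le> ereal (p \<bullet> u - c)"
    and c: "convex_conjugate h p = ereal c"
  shows "u \<in> subdifferential (convex_conjugate h) p"
proof -
  have "ereal (c + u \<bullet> (q - p)) \<le> convex_conjugate h q" for q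
  proof -
    have "h u \<noteq> -\<infinity>" using h by (auto simp: proper_fun_def)
    then have "ereal (c + u \<bullet> (q - p)) \<le> ereal (q \<bullet> u) - h u"
      using hu by (cases "h u") (auto simp: inner_diff_right inner_commute)
    then show ?thesis using conjugate_upper order_trans by blast
  qed
  then show ?thesis using c by (simp add: subdifferential_def)
qed

text \<open>One half of the reduction lemma for polyhedral functions. Only the finitely many vertices of
  the epigraph intersected with a box have to be checked.\<close>

lemma subdifferential_conjugate_shift:
  fixes h :: "'a::euclidean_space \<Rightarrow> ereal"
  assumes h: "proper_fun h" and poly: "polyhedron (epi h)"
    and u0: "u0 \<in> subdifferential (convex_conjugate h) p0"
  obtains \<delta> where "\<delta> > 0"
    and "\<And>k u. \<lbrakk>k \<in> critical_cone (convex_conjugate h) p0 u0; norm k < \<delta>;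
           u \<in> subdifferential (convex_conjugate h) p0; k \<bullet> (u - u0) = 0\<rbrakk>
         \<Longrightarrow> u \<in> subdifferential (convex_conjugate h) (p0 + k)"
proof -
  have fin: "\<And>z. h z \<noteq> -\<infinity>" using h by (auto simp: proper_fun_def)
  have cl: "closed (epi h)" and cv: "convex (epi h)"
    using poly by (auto simp: polyhedron_imp_closed polyhedron_imp_convex)
  obtain c where c: "convex_conjugate h p0 = ereal c" using u0 by (rule subdifferential_real)
  have val: "h u = ereal (p0 \<bullet> u - c)" if "u \<in> subdifferential (convex_conjugate h) p0" for u
    using subdifferential_conjugate_value[OF h cl cv that c] .
  have c_ge: "p0 \<bullet> z - a \<le> c" if "(z, a) \<in> epi h" for z a
    using that conjugate_le_iff[where h = h, OF fin, of p0 c] c by auto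
  let ?e = "(u0, p0 \<bullet> u0 - c)"
  have e_epi: "?e \<in> epi h" using val[OF u0] by (simp add: epi_def)
  define B where "B = cbox (?e - One) (?e + One)"
  have e_int: "?e \<in> interior B"
    unfolding B_def interior_cbox by (auto simp: mem_box inner_diff_left inner_add_left)
  have "polytope (epi h \<inter> B)"
    by (intro polyhedron_Int_polytope poly) (simp add: B_def polytope_interval)
  then obtain V where V: "finite V" "epi h \<inter> B = convex hull V" by (auto simp: polytope_def)
  have V_epi: "v \<in> epi h" if "v \<in> V" for v using V that hull_inc by fastforce
  let ?K = "critical_cone (convex_conjugate h) p0 u0"
  \<comment> \<open>If the vertex lies on the supporting hyperplane of \<open>p0\<close>, its first
    component is a subgradient at \<open>p0\<close> and the sign comes from \<open>k\<close> being
    in the normal cone. Otherwise it stays below by a gap \<open>s > 0\<close>, which a small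
    \<open>k\<close> cannot close.\<close>
  have "\<exists>\<delta>>0. \<forall>k\<in>?K. norm k < \<delta> \<longrightarrow> (p0 + k, -1) \<bullet> (v - ?e) \<le> 0" if "v \<in> V" for v
  proof -
    obtain z a where v: "v = (z, a)" by (cases v)
    have va: "(z, a) \<in> epi h" using V_epi that v by blast
    show ?thesis
    proof (cases "p0 \<bullet> z - a = c")
      case True
      then have "h z \<le> ereal (p0 \<bullet> z - c)" using va by (auto simp: epi_def)
      then have "z \<in> subdifferential (convex_conjugate h) p0"
        by (rule subdifferential_conjugateI[OF h _ c])
      then have "k \<bullet> (z - u0) \<le> 0" if "k \<in> ?K" for k
        using that by (auto simp: critical_cone_def normal_cone_def)
      then have "(p0 + k, -1) \<bullet> (v - ?e) \<le> 0" if "k \<in> ?K" for k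
        using True that by (simp add: v inner_add_left inner_diff_right algebra_simps)
      then show ?thesis by (intro exI[of _ 1]) auto
    next
      case False
      define s where "s = c - (p0 \<bullet> z - a)"
      have s: "s > 0" using False c_ge[OF va] by (simp add: s_def)
      \<comment> \<open>The added 1 keeps the denominator positive when
        \<open>z = u0\<close>.\<close>
      define \<delta> where "\<delta> = s / (norm (z - u0) + 1)"
      have "\<delta> > 0" using s by (simp add: \<delta>_def add_nonneg_pos)
      moreover have "(p0 + k, -1) \<bullet> (v - ?e) \<le> 0" if "norm k < \<delta>" for k
      proof -
        have "k \<bullet> (z - u0) \<le> norm k * norm (z - u0)" by (rule norm_cauchy_schwarz)
        also have "\<dots> \<le> norm k * (norm (z - u0) + 1)" by (simp add: mult_left_mono)
        also have "\<dots> \<le> \<delta> * (norm (z - u0) + 1)" using that by (intro mult_right_mono) auto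
        also have "\<dots> = s"
          using norm_ge_zero[of "z - u0"] unfolding \<delta>_def by (simp add: add_nonneg_eq_0_iff)
        finally show ?thesis
          by (simp add: v s_def inner_add_left inner_diff_right algebra_simps)
      qed
      ultimately show ?thesis by blast
    qed
  qed
  then obtain d where d: "\<And>v. v \<in> V \<Longrightarrow> d v > 0"
    "\<And>v k. \<lbrakk>v \<in> V; k \<in> ?K; norm k < d v\<rbrakk> \<Longrightarrow> (p0 + k, -1) \<bullet> (v - ?e) \<le> 0"
    by metis
  define \<delta> where "\<delta> = Min (insert 1 (d ` V))"
  have \<delta>: "\<delta> > 0" "\<And>v. v \<in> V \<Longrightarrow> \<delta> \<le> d v"
    using V(1) d(1) by (auto simp: \<delta>_def)
  show thesis
  proof (rule that[OF \<delta>(1)])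
    fix k u
    assume k: "k \<in> ?K" "norm k < \<delta>"
      and u: "u \<in> subdifferential (convex_conjugate h) p0" and ku: "k \<bullet> (u - u0) = 0"
    let ?n = "(p0 + k, -1) :: 'a \<times> real"
    have "V \<subseteq> {e. ?n \<bullet> e \<le> ?n \<bullet> ?e}"
      using d(2)[OF _ k(1)] \<delta>(2) k(2) by (force simp: inner_diff_right)
    then have box: "?n \<bullet> e \<le> ?n \<bullet> ?e" if "e \<in> epi h \<inter> B" for e
      using hull_minimal[of V "{e. ?n \<bullet> e \<le> ?n \<bullet> ?e}" convex, OF _ convex_halfspace_le]
        that V(2) by blast
    \<comment> \<open>From the box to the whole epigraph: the segment from \<open>?e\<close> to
      \<open>e\<close> stays in the epigraph and starts in the interior of the box, and a linear
      inequality at a point of the segment other than \<open>?e\<close> extends to its end.\<close>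
    have all: "?n \<bullet> e \<le> ?n \<bullet> ?e" if e: "e \<in> epi h" for e
    proof -
      have "\<forall>\<^sub>F \<epsilon> in at_right 0. (1 - \<epsilon>) *\<^sub>R ?e + \<epsilon> *\<^sub>R e \<in> interior B"
      proof (rule topological_tendstoD[OF _ open_interior e_int])
        show "((\<lambda>\<epsilon>. (1 - \<epsilon>) *\<^sub>R ?e + \<epsilon> *\<^sub>R e) \<longlongrightarrow> ?e) (at_right 0)"
          by (auto intro!: tendsto_eq_intros simp del: scaleR_Pair)
      qed
      moreover have "\<forall>\<^sub>F \<epsilon> in at_right 0. \<epsilon> \<in> {0<..<1::real}"
        by (rule eventually_at_right_real) simp
      ultimately have "\<forall>\<^sub>F \<epsilon> in at_right (0::real).
          (1 - \<epsilon>) *\<^sub>R ?e + \<epsilon> *\<^sub>R e \<in> interior B \<and> \<epsilon> \<in> {0<..<1}"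
        by eventually_elim simp
      then obtain \<epsilon> :: real where \<epsilon>: "(1 - \<epsilon>) *\<^sub>R ?e + \<epsilon> *\<^sub>R e \<in> interior B" "0 < \<epsilon>" "\<epsilon> < 1"
        using eventually_happens'[OF trivial_limit_at_right_real] by fastforce
      have "(1 - \<epsilon>) *\<^sub>R ?e + \<epsilon> *\<^sub>R e \<in> epi h"
        using \<epsilon> by (intro convexD[OF cv e_epi e]) auto
      then have "?n \<bullet> ((1 - \<epsilon>) *\<^sub>R ?e + \<epsilon> *\<^sub>R e) \<le> ?n \<bullet> ?e"
        using \<epsilon>(1) interior_subset[of B] by (intro box) auto
      then have "\<epsilon> * (?n \<bullet> e) \<le> \<epsilon> * (?n \<bullet> ?e)"
        by (simp only: inner_add_right inner_scaleR_right) (simp only: algebra_simps)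
      then show ?thesis using \<epsilon>(2) by (simp only: mult_le_cancel_left_pos)
    qed
    \<comment> \<open>Since \<open>?e\<close> maximizes the functional with normal
      \<open>(p0 + k, -1)\<close>, the conjugate is affine in the direction \<open>k\<close>; the
      reverse inequality is the subgradient property of \<open>u0\<close>.\<close>
    have "convex_conjugate h (p0 + k) \<le> ereal (c + k \<bullet> u0)"
      unfolding conjugate_le_iff[where h = h, OF fin] using all by (auto simp: inner_add_left add.commute[of c])
    moreover have "ereal (c + k \<bullet> u0) \<le> convex_conjugate h (p0 + k)"
      using u0 c by (auto simp: subdifferential_def inner_commute dest: spec[of _ "p0 + k"])
    ultimately have ck: "convex_conjugate h (p0 + k) = ereal (c + k \<bullet> u0)" by simp
    show "u \<in> subdifferential (convex_conjugate h) (p0 + k)"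
      by (rule subdifferential_conjugateI[OF h _ ck])
        (use val[OF u] ku in \<open>simp add: inner_add_left inner_diff_right\<close>)
  qed
qed

text \<open>If \<open>p $ i < 0\<close>, lowering the i-th coordinate of \<open>z\<close> raises
  \<open>p \<bullet> z\<close> without bound but never raises \<open>h\<close>, so the conjugate
  would be infinite. This sign makes the Lagrangian convex in \<open>y\<close>.\<close>

lemma conjugate_domain_nonneg:
  fixes h :: "real^'s \<Rightarrow> ereal"
  assumes h: "proper_fun h" and mono: "\<And>z z'. (\<forall>i. z' $ i \<le> z $ i) \<Longrightarrow> h z' \<le> h z"
    and fin: "convex_conjugate h p \<noteq> \<infinity>"
  shows "0 \<le> p $ i"
proof (rule ccontr)
  assume neg: "\<not> 0 \<le> p $ i"
  have h_fin: "\<And>z. h z \<noteq> -\<infinity>" using h by (auto simp: proper_fun_def)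
  obtain c where c: "convex_conjugate h p = ereal c"
    using fin conjugate_not_minus_infinity[OF h, of p] by (cases "convex_conjugate h p") auto
  obtain z0 a0 where z0: "h z0 \<le> ereal a0"
    using h by (auto simp: proper_fun_def) (metis ereal_less_eq(2) ereal_cases order_refl)
  \<comment> \<open>Chosen so that \<open>p \<bullet> ?z - a0\<close> is at least
    \<open>c + 1\<close>.\<close>
  define t where "t = (\<bar>c - p \<bullet> z0 + a0\<bar> + 1) / (- p $ i)"
  have t: "t \<ge> 0" using neg by (simp add: t_def divide_nonneg_neg)
  let ?z = "z0 - t *\<^sub>R axis i 1"
  have "h ?z \<le> h z0" using t by (intro mono) (simp add: axis_def)
  then have "(?z, a0) \<in> epi h" using z0 by (auto simp: epi_def)
  then have "p \<bullet> ?z - a0 \<le> c" using conjugate_le_iff[where h = h, OF h_fin, of p c] c by auto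
  moreover have "p \<bullet> ?z = p \<bullet> z0 + (\<bar>c - p \<bullet> z0 + a0\<bar> + 1)"
    using neg by (simp add: inner_diff_right inner_add_right inner_axis t_def)
  ultimately show False by linarith
qed

section \<open>Relative interior points and critical cones\<close>

lemma orthogonal_projection:
  fixes S :: "'a::euclidean_space set"
  assumes "subspace S"
  obtains Q where "bounded_linear Q" "\<And>v. Q v \<in> S" "\<And>v. v - Q v \<in> S\<^sup>\<bottom>"
proof -
  obtain B where B: "B \<subseteq> S" "pairwise orthogonal B" "\<And>b. b \<in> B \<Longrightarrow> norm b = 1"
    "independent B" "span B = S"
    using orthonormal_basis_subspace[OF assms] by metis
  have fin: "finite B" using B(4) by (rule independent_imp_finite)
  define Q where "Q v = (\<Sum>b\<in>B. (v \<bullet> b) *\<^sub>R b)" for v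
  show thesis
  proof (rule that)
    show "bounded_linear Q"
      unfolding Q_def
      by (intro bounded_linear_sum bounded_linear_scaleR_const bounded_linear_inner_left)
    show "Q v \<in> S" for v
      using B(1) unfolding Q_def by (intro subspace_sum[OF assms] subspace_scale[OF assms]) auto
    show "v - Q v \<in> S\<^sup>\<bottom>" for v
    proof -
      have "orthogonal (v - Q v) b" if b: "b \<in> B" for b
      proof -
        have "Q v \<bullet> b = (\<Sum>c\<in>B. if c = b then v \<bullet> b else 0)"
          unfolding Q_def inner_sum_left
        proof (rule sum.cong[OF refl])
          fix c assume c: "c \<in> B"
          then show "(v \<bullet> c) *\<^sub>R c \<bullet> b = (if c = b then v \<bullet> b else 0)"
            using B(2,3) b by (auto simp: pairwise_def orthogonal_def dot_square_norm)
        qed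
        then show ?thesis using fin b by (simp add: orthogonal_def inner_diff_left)
      qed
      then have "orthogonal (v - Q v) s" if "s \<in> S" for s
        using that B(5) orthogonal_to_span by blast
      then show ?thesis by (auto simp: orthogonal_comp_def orthogonal_commute)
    qed
  qed
qed

text \<open>From a relative interior point one can move a little along both \<open>s\<close> and
  \<open>- s\<close> for every direction \<open>s\<close> of the affine hull, so a normal vector has
  inner product at most 0 with both.\<close>

lemma normal_cone_rel_interior:
  fixes D :: "'a::euclidean_space set"
  assumes "u \<in> rel_interior D"
  shows "normal_cone D u = (span ((\<lambda>z. - u + z) ` D))\<^sup>\<bottom>" (is "_ = ?S\<^sup>\<bottom>")
proof safe
  obtain e where uD: "u \<in> D" and e: "e > 0" "ball u e \<inter> affine hull D \<subseteq> D"
    using assms by (auto simp: mem_rel_interior_ball)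
  have aff: "affine hull D = (\<lambda>x. u + x) ` ?S"
    using uD by (intro affine_hull_span_gen hull_inc)
  {
    fix v assume v: "v \<in> normal_cone D u"
    have "orthogonal s v" if s: "s \<in> ?S" for s
    proof -
      have le: "v \<bullet> s \<le> 0" if s: "s \<in> ?S" for s
      proof -
        define t where "t = e / (norm s + 1)"
        have pos: "norm s + 1 > 0" using norm_ge_zero[of s] by linarith
        have t: "t > 0" using e(1) pos by (simp add: t_def)
        have "norm (t *\<^sub>R s) < e"
          using t e(1) pos by (simp add: t_def field_simps)
        then have "u + t *\<^sub>R s \<in> ball u e" by (simp add: dist_norm)
        moreover have "u + t *\<^sub>R s \<in> affine hull D" using s by (simp add: aff span_mul)
        ultimately have "u + t *\<^sub>R s \<in> D" using e(2) by blast
        then have "v \<bullet> (u + t *\<^sub>R s - u) \<le> 0"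
          using v unfolding normal_cone_def by blast
        then show ?thesis using t by (simp add: mult_le_0_iff)
      qed
      show ?thesis using le[OF s] le[OF span_neg[OF s]] by (simp add: orthogonal_def inner_commute)
    qed
    then show "v \<in> ?S\<^sup>\<bottom>" by (simp add: orthogonal_comp_def)
  next
    fix v assume v: "v \<in> ?S\<^sup>\<bottom>"
    have "v \<bullet> (z - u) = 0" if "z \<in> D" for z
    proof -
      have "z - u \<in> ?S" using that by (auto intro!: span_base image_eqI[of _ _ z])
      then show ?thesis using v by (auto simp: orthogonal_comp_def orthogonal_def inner_commute)
    qed
    then show "v \<in> normal_cone D u" using uD by (simp add: normal_cone_def)
  }
qed

text \<open>\<open>S\<close> is the direction space of the affine hull of the subdifferential at
  \<open>p0\<close>. Relative interiority lets \<open>u\<close> move freely in \<open>S\<close> near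
  \<open>u0\<close>; the shift lemma then moves \<open>p\<close>, its orthogonality condition being
  automatic. This gives the affine piece of the graph.\<close>

lemma subdifferential_conjugate_rel_interior:
  fixes h :: "'a::euclidean_space \<Rightarrow> ereal"
  assumes h: "proper_fun h" and poly: "polyhedron (epi h)"
    and ri: "u0 \<in> rel_interior (subdifferential (convex_conjugate h) p0)"
  obtains S \<delta> where "subspace S" "critical_cone (convex_conjugate h) p0 u0 = S\<^sup>\<bottom>" "\<delta> > 0"
    and "\<And>p u. \<lbrakk>p - p0 \<in> S\<^sup>\<bottom>; norm (p - p0) < \<delta>; u - u0 \<in> S; norm (u - u0) < \<delta>\<rbrakk>
         \<Longrightarrow> u \<in> subdifferential (convex_conjugate h) p"
proof -
  let ?D = "subdifferential (convex_conjugate h) p0"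
  let ?S = "span ((\<lambda>z. - u0 + z) ` ?D)"
  have uD: "u0 \<in> ?D" using ri by (rule subsetD[OF rel_interior_subset])
  obtain e where e: "e > 0" "ball u0 e \<inter> affine hull ?D \<subseteq> ?D"
    using ri by (auto simp: mem_rel_interior_ball)
  have aff: "affine hull ?D = (\<lambda>x. u0 + x) ` ?S"
    using uD by (intro affine_hull_span_gen hull_inc)
  have K: "critical_cone (convex_conjugate h) p0 u0 = ?S\<^sup>\<bottom>"
    unfolding critical_cone_def by (rule normal_cone_rel_interior[OF ri])
  obtain d where d: "d > 0"
    "\<And>k u. \<lbrakk>k \<in> ?S\<^sup>\<bottom>; norm k < d; u \<in> ?D; k \<bullet> (u - u0) = 0\<rbrakk>
      \<Longrightarrow> u \<in> subdifferential (convex_conjugate h) (p0 + k)"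
    using subdifferential_conjugate_shift[OF h poly uD] unfolding K by metis
  show thesis
  proof (rule that[OF subspace_span K, of "min d e"])
    show "min d e > 0" using d(1) e(1) by simp
    fix p u
    assume p: "p - p0 \<in> ?S\<^sup>\<bottom>" "norm (p - p0) < min d e" and u: "u - u0 \<in> ?S" "norm (u - u0) < min d e"
    have "u \<in> affine hull ?D" unfolding aff using u(1) by (intro image_eqI[of _ _ "u - u0"]) auto
    moreover have "u \<in> ball u0 e" using u(2) by (simp add: dist_norm norm_minus_commute)
    ultimately have "u \<in> ?D" using e(2) by blast
    moreover have "(p - p0) \<bullet> (u - u0) = 0"
      using p(1) u(1) by (auto simp: orthogonal_comp_def orthogonal_def inner_commute)
    ultimately have "u \<in> subdifferential (convex_conjugate h) (p0 + (p - p0))"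
      using p by (intro d(2)) auto
    then show "u \<in> subdifferential (convex_conjugate h) p" by simp
  qed
qed

section \<open>Partial gradients\<close>

text \<open>The adjoint of the partial derivative \<open>w \<mapsto> A (0, w)\<close>, applied to
  \<open>p\<close>. As a bounded bilinear operation in \<open>A\<close> and \<open>p\<close> it
  falls under the product rule; with \<open>p = 1\<close> it turns the derivative of a real function
  into its partial gradient.\<close>

definition partial_adjoint ::
  "(('x::real_normed_vector \<times> 'y::euclidean_space) \<Rightarrow>\<^sub>L 'z::real_inner) \<Rightarrow> 'z \<Rightarrow> 'y" where
  "partial_adjoint A p = (\<Sum>b\<in>Basis. (A (0, b) \<bullet> p) *\<^sub>R b)"

lemma inner_partial_adjoint: "w \<bullet> partial_adjoint A p = A (0, w) \<bullet> p"
proof -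
  have lin: "bounded_linear (\<lambda>w. A (0, w) \<bullet> p)"
    by (intro bounded_linear_inner_left_comp blinfun.bounded_linear_right[THEN bounded_linear_compose]
        bounded_linear_Pair bounded_linear_ident bounded_linear_zero)
  have "A (0, w) \<bullet> p = A (0, \<Sum>b\<in>Basis. (w \<bullet> b) *\<^sub>R b) \<bullet> p"
    by (simp add: euclidean_representation)
  also have "\<dots> = (\<Sum>b\<in>Basis. (w \<bullet> b) * (A (0, b) \<bullet> p))"
    using linear_sum[OF bounded_linear.linear[OF lin], of "\<lambda>b. (w \<bullet> b) *\<^sub>R b" Basis]
      linear_scale[OF bounded_linear.linear[OF lin]] by simp
  also have "\<dots> = w \<bullet> partial_adjoint A p"
    by (simp add: partial_adjoint_def inner_sum_right mult.commute)
  finally show ?thesis by simp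
qed

lemma partial_adjoint_eqI: "(\<And>w. w \<bullet> d = blinfun_apply A (0, w) \<bullet> p) \<Longrightarrow> d = partial_adjoint A p"
  by (metis inner_partial_adjoint vector_eq_ldot)

lemma bounded_bilinear_partial_adjoint:
  "bounded_bilinear (partial_adjoint ::
    (('a::real_normed_vector \<times> 'b::euclidean_space) \<Rightarrow>\<^sub>L 'c::real_inner) \<Rightarrow> 'c \<Rightarrow> 'b)"
proof
  show "\<exists>K. \<forall>(A :: ('a \<times> 'b) \<Rightarrow>\<^sub>L 'c) p. norm (partial_adjoint A p) \<le> norm A * norm p * K"
  proof (intro exI allI)
    fix A :: "('a \<times> 'b) \<Rightarrow>\<^sub>L 'c" and p :: 'c
    let ?w = "partial_adjoint A p"
    \<comment> \<open>Testing the adjoint identity with its own value \<open>?w\<close> gives the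
      bound with constant 1.\<close>
    have "norm ?w * norm ?w = ?w \<bullet> ?w"
      by (metis dot_square_norm power2_eq_square)
    also have "\<dots> = A (0, ?w) \<bullet> p" by (rule inner_partial_adjoint)
    also have "\<dots> \<le> norm (A (0, ?w)) * norm p" by (rule norm_cauchy_schwarz)
    also have "\<dots> \<le> norm A * norm ?w * norm p"
      using norm_blinfun[of A "(0, ?w)"] by (simp add: mult_right_mono norm_Pair)
    finally have "norm ?w * norm ?w \<le> norm ?w * (norm A * norm p)" by (simp add: mult.commute mult.left_commute)
    then show "norm ?w \<le> norm A * norm p * 1"
      by (cases "?w = 0") (auto simp: mult_le_cancel_left)
  qed
qed (rule sym, rule partial_adjoint_eqI,
    simp add: blinfun.bilinear_simps inner_add_left inner_add_right inner_partial_adjoint)+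

lemmas C1_on_scaleR = bounded_bilinear.C1_on_bilinear[OF bounded_bilinear_scaleR]
lemmas C1_on_partial_adjoint = bounded_bilinear.C1_on_bilinear[OF bounded_bilinear_partial_adjoint]

lemmas C1_on_intros = C1_on_ident C1_on_const C1_on_fst C1_on_snd C1_on_Pair C1_on_add C1_on_diff
  C1_on_scaleR C1_on_partial_adjoint

lemma has_derivative_section:
  assumes "f differentiable at (x, y)"
  shows "((\<lambda>y'. f (x, y')) has_derivative (\<lambda>w. total_deriv f (x, y) (0, w))) (at y)"
proof -
  have "((\<lambda>y'. (x, y')) has_derivative (\<lambda>w. (0, w))) (at y)"
    by (intro derivative_intros)
  from diff_chain_at[OF this has_derivative_total_deriv[OF assms]] show ?thesis
    by (simp add: o_def)
qed

lemma grad_eq: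
  assumes "GDERIV f y :> d" shows "grad f y = d"
  unfolding grad_def
proof (rule the_equality)
  fix d' assume "GDERIV f y :> d'"
  then have "(\<lambda>h. h \<bullet> d') = (\<lambda>h. h \<bullet> d)"
    using assms unfolding gderiv_def by (rule has_derivative_unique)
  then show "d' = d" by (metis inner_commute vector_eq_rdot)
qed fact

lemma grad_y_eq:
  assumes "g differentiable at (x, y)"
  shows "grad_y g x y = partial_adjoint (total_deriv g (x, y)) 1"
  unfolding grad_y_def
  using has_derivative_section[OF assms]
  by (intro grad_eq) (simp add: gderiv_def inner_partial_adjoint)

lemma jac_y_mult:
  assumes "G differentiable at (x, y)"
  shows "jac_y G x y *v w = total_deriv G (x, y) (0, w)"
proof -
  note D = has_derivative_section[OF assms]
  then have "((\<lambda>y'. G (x, y')) has_derivative (\<lambda>w. jac_y G x y *v w)) (at y)"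
    unfolding jac_y_def by (simp add: differentiable_def flip: jacobian_works) blast
  from has_derivative_unique[OF this D] show ?thesis by metis
qed

lemma transpose_jac_y_mult:
  assumes "G differentiable at (x, y)"
  shows "transpose (jac_y G x y) *v p = partial_adjoint (total_deriv G (x, y)) p"
proof (rule partial_adjoint_eqI)
  fix w
  have "w \<bullet> (transpose (jac_y G x y) *v p) = p \<bullet> (jac_y G x y *v w)"
    by (metis dot_lmul_matrix inner_commute transpose_matrix_vector)
  then show "w \<bullet> (transpose (jac_y G x y) *v p) = total_deriv G (x, y) (0, w) \<bullet> p"
    by (simp only: jac_y_mult[OF assms] inner_commute)
qed

section \<open>The perturbed optimality system\<close>

text \<open>Restriction to the line through \<open>y\<close> and \<open>y'\<close> reduces this to
  the tangent inequality in one variable.\<close>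

lemma convex_on_above_gradient:
  fixes f :: "'a::real_inner \<Rightarrow> real"
  assumes f: "convex_on UNIV f" and d: "GDERIV f y :> d"
  shows "f y + (y' - y) \<bullet> d \<le> f y'"
proof -
  define \<phi> where "\<phi> t = f (y + t *\<^sub>R (y' - y))" for t
  have "convex_on UNIV \<phi>"
  proof (rule convex_onI)
    fix t s r :: real assume t: "0 < t" "t < 1"
    have "y + ((1 - t) *\<^sub>R s + t *\<^sub>R r) *\<^sub>R (y' - y)
        = (1 - t) *\<^sub>R (y + s *\<^sub>R (y' - y)) + t *\<^sub>R (y + r *\<^sub>R (y' - y))"
      by (simp add: algebra_simps)
    then show "\<phi> ((1 - t) *\<^sub>R s + t *\<^sub>R r) \<le> (1 - t) * \<phi> s + t * \<phi> r"
      using convex_onD[OF f, of t] t by (simp add: \<phi>_def)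
  qed simp
  moreover have "(\<phi> has_field_derivative (y' - y) \<bullet> d) (at 0)"
  proof -
    have "((\<lambda>t. y + t *\<^sub>R (y' - y)) has_derivative (\<lambda>t. t *\<^sub>R (y' - y))) (at 0)"
      by (auto intro!: derivative_eq_intros)
    moreover have "(f has_derivative (\<lambda>w. w \<bullet> d)) (at (y + 0 *\<^sub>R (y' - y)))"
      using d by (simp add: gderiv_def)
    ultimately have "(f \<circ> (\<lambda>t. y + t *\<^sub>R (y' - y)) has_derivative
        (\<lambda>w. w \<bullet> d) \<circ> (\<lambda>t. t *\<^sub>R (y' - y))) (at 0)"
      by (rule diff_chain_at)
    moreover have "(\<lambda>w. w \<bullet> d) \<circ> (\<lambda>t. t *\<^sub>R (y' - y)) = (*) ((y' - y) \<bullet> d)"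
      by (simp add: fun_eq_iff)
    ultimately show ?thesis
      by (simp add: has_field_derivative_def \<phi>_def[abs_def] o_def)
  qed
  ultimately have "((y' - y) \<bullet> d) * (1 - 0) \<le> \<phi> 1 - \<phi> 0"
    by (intro convex_on_imp_above_tangent[of UNIV]) auto
  then show ?thesis by (simp add: \<phi>_def)
qed

text \<open>The shifts \<open>a\<close> and \<open>b\<close> allow regularization centred anywhere:
  \<open>a = \<beta> y0\<close> and \<open>b = \<alpha> p0\<close> turn the added terms into
  \<open>\<beta> (y - y0)\<close> and \<open>\<alpha> (p - p0)\<close>. All parameters form one
  tuple, which serves as the variable of the implicit function theorem.\<close>

definition perturbed_sol ::
  "('x \<times> (real^'m) \<Rightarrow> real) \<Rightarrow> ('x \<times> (real^'m) \<Rightarrow> real^'s) \<Rightarrow> (real^'s \<Rightarrow> ereal)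
     \<Rightarrow> 'x \<times> real \<times> real \<times> (real^'m) \<times> (real^'s) \<Rightarrow> ((real^'m) \<times> (real^'s)) set" where
  "perturbed_sol g G h = (\<lambda>(x, \<alpha>, \<beta>, a, b).
     {(y, p). grad_y g x y + transpose (jac_y G x y) *v p + \<beta> *\<^sub>R y - a = 0 \<and>
              G (x, y) - \<alpha> *\<^sub>R p + b \<in> subdifferential (convex_conjugate h) p})"

lemma sol_reg_eq_perturbed_sol:
  fixes G :: "'x \<times> (real^'m) \<Rightarrow> real^'s"
  shows "sol_reg g G h \<alpha> \<beta> x = perturbed_sol g G h (x, \<alpha>, \<beta>, 0, 0)"
proof -
  have "0 = - A - B - C \<longleftrightarrow> A + B + C - 0 = 0" for A B C :: "real^'m"
  proof -
    have "- A - B - C = - (A + B + C)" by simp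
    then show ?thesis by (simp only: neg_equal_0_iff_equal diff_0_right eq_commute[of 0])
  qed
  moreover have "0 \<in> (\<lambda>v. - u + q + v) ` D \<longleftrightarrow> u - q + 0 \<in> D" for u q :: "real^'s" and D
    by (auto simp: image_iff add_eq_0_iff intro!: bexI[of _ "u - q"])
  ultimately show ?thesis
    by (simp only: sol_reg_def perturbed_sol_def case_prod_conv)
qed

lemma sol_eq_perturbed_sol: "sol g G h x = perturbed_sol g G h (x, 0, 0, 0, 0)"
  by (simp add: sol_def sol_reg_def flip: sol_reg_eq_perturbed_sol)

locale composite_problem =
  fixes g :: "(real^'n) \<times> (real^'m) \<Rightarrow> real"
    and G :: "(real^'n) \<times> (real^'m) \<Rightarrow> real^'s"
    and h :: "real^'s \<Rightarrow> ereal"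
  assumes g_C2: "C2_on UNIV g"
    and G_C2: "C2_on UNIV G"
    and g_convex: "\<And>x'. convex_on UNIV (\<lambda>y. g (x', y))"
    and G_convex: "\<And>x' i. convex_on UNIV (\<lambda>y. G (x', y) $ i)"
    and h_proper: "proper_fun h"
    and h_epi_polyhedral: "polyhedron (epi h)"
    and h_nondecreasing: "\<And>z z'. (\<forall>i. z' $ i \<le> z $ i) \<Longrightarrow> h z' \<le> h z"
begin

lemma C1: "C1_on UNIV g" "C1_on UNIV G" "C1_on UNIV (total_deriv g)" "C1_on UNIV (total_deriv G)"
  using g_C2 G_C2 by (auto simp: C2_on_def)

lemma differentiable: "g differentiable at z" "G differentiable at z"
  "total_deriv g differentiable at z" "total_deriv G differentiable at z"
  using C1 unfolding C1_on_def by blast+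

definition lagrangian_grad :: "(real^'n) \<times> (real^'m) \<Rightarrow> real^'s \<Rightarrow> real^'m" where
  "lagrangian_grad z p = partial_adjoint (total_deriv g z) 1 + partial_adjoint (total_deriv G z) p"

lemma lagrangian_grad_eq:
  "grad_y g x y + transpose (jac_y G x y) *v p = lagrangian_grad (x, y) p"
  unfolding lagrangian_grad_def
  by (simp only: grad_y_eq[OF differentiable(1)] transpose_jac_y_mult[OF differentiable(2)])

lemma GDERIV_lagrangian:
  "GDERIV (\<lambda>y. g (x, y) + G (x, y) \<bullet> p - c) y :> lagrangian_grad (x, y) p"
  unfolding gderiv_def
  by (rule derivative_eq_intros has_derivative_section differentiable refl)+
    (simp add: lagrangian_grad_def inner_add_right inner_partial_adjoint)

lemma lagrangian_above_gradient:
  assumes "\<And>i. 0 \<le> p $ i"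
  shows "g (x, y) + G (x, y) \<bullet> p + (y' - y) \<bullet> lagrangian_grad (x, y) p \<le> g (x, y') + G (x, y') \<bullet> p"
proof -
  have "convex_on UNIV (\<lambda>y. \<Sum>i\<in>I. p $ i * G (x, y) $ i)" if "finite I" for I
    using that
    by induction (auto intro!: convex_on_add convex_on_cmul G_convex assms simp: convex_on_const)
  then have "convex_on UNIV (\<lambda>y. g (x, y) + (\<Sum>i\<in>UNIV. p $ i * G (x, y) $ i))"
    by (intro convex_on_add g_convex) simp
  then have "convex_on UNIV (\<lambda>y. g (x, y) + G (x, y) \<bullet> p - 0)"
    by (simp add: inner_vec_def mult.commute)
  from convex_on_above_gradient[OF this GDERIV_lagrangian] show ?thesis by simp
qed

text \<open>Finiteness of the conjugate at \<open>p\<close> makes the real part of the Lagrangian a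
  smooth function minus a constant; its gradient \<open>lagrangian_grad\<close> is then
  differentiated once more in \<open>y\<close>.\<close>

lemma hess_yy_lagrangian_mult:
  assumes "\<bar>convex_conjugate h p\<bar> \<noteq> \<infinity>"
  shows "hess_yy_lagrangian g G h x y p *v w
    = partial_adjoint (total_deriv (total_deriv g) (x, y) (0, w)) 1
      + partial_adjoint (total_deriv (total_deriv G) (x, y) (0, w)) p"
proof -
  obtain c where c: "convex_conjugate h p = ereal c"
    using assms by (cases "convex_conjugate h p") auto
  have grad: "grad (\<lambda>y'. real_of_ereal (lagrangian g G h x y' p)) = (\<lambda>y'. lagrangian_grad (x, y') p)"
    by (rule ext, rule grad_eq) (simp add: lagrangian_def c GDERIV_lagrangian)
  have D: "((\<lambda>y'. lagrangian_grad (x, y') p) has_derivative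
      (\<lambda>w. partial_adjoint (total_deriv (total_deriv g) (x, y) (0, w)) 1
      + partial_adjoint (total_deriv (total_deriv G) (x, y) (0, w)) p)) (at y)"
    unfolding lagrangian_grad_def
    by (intro has_derivative_add has_derivative_section differentiable
        bounded_linear.has_derivative[OF bounded_bilinear.bounded_linear_left[OF bounded_bilinear_partial_adjoint]])
  then have "((\<lambda>y'. lagrangian_grad (x, y') p) has_derivative
      (\<lambda>w. hess_yy_lagrangian g G h x y p *v w)) (at y)"
    unfolding hess_yy_lagrangian_def hessian_def grad
    by (simp add: differentiable_def flip: jacobian_works) blast
  from has_derivative_unique[OF this D] show ?thesis by metis
qed

text \<open>Each solution gives a gradient inequality for the Lagrangian, convex in \<open>y\<close>
  because its multiplier is nonnegative, and a subgradient inequality for the conjugate, both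
  evaluated at the other solution. In the sum of all four the coupling terms in \<open>G\<close>
  cancel and only the two squared distances, weighted by \<alpha> and \<beta>, remain.\<close>

lemma perturbed_sol_unique:
  assumes 1: "(y1, p1) \<in> perturbed_sol g G h (x, \<alpha>, \<beta>, a, b)"
    and 2: "(y2, p2) \<in> perturbed_sol g G h (x, \<alpha>, \<beta>, a, b)"
    and pos: "\<alpha> > 0" "\<beta> > 0"
  shows "y1 = y2 \<and> p1 = p2"
proof -
  have sol: "g (x, y) + G (x, y) \<bullet> p + (y' - y) \<bullet> (a - \<beta> *\<^sub>R y) \<le> g (x, y') + G (x, y') \<bullet> p"
    "G (x, y) - \<alpha> *\<^sub>R p + b \<in> subdifferential (convex_conjugate h) p"
    if "(y, p) \<in> perturbed_sol g G h (x, \<alpha>, \<beta>, a, b)" for y p y'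
  proof -
    have eq: "lagrangian_grad (x, y) p = a - \<beta> *\<^sub>R y"
      and sub: "G (x, y) - \<alpha> *\<^sub>R p + b \<in> subdifferential (convex_conjugate h) p"
      using that unfolding perturbed_sol_def lagrangian_grad_eq by (auto simp: algebra_simps)
    show "G (x, y) - \<alpha> *\<^sub>R p + b \<in> subdifferential (convex_conjugate h) p" by (fact sub)
    have "0 \<le> p $ i" for i
      using sub by (intro conjugate_domain_nonneg[OF h_proper h_nondecreasing])
        (auto simp: subdifferential_def)
    from lagrangian_above_gradient[OF this, of x y y']
    show "g (x, y) + G (x, y) \<bullet> p + (y' - y) \<bullet> (a - \<beta> *\<^sub>R y) \<le> g (x, y') + G (x, y') \<bullet> p"
      by (simp only: eq)
  qed
  obtain c1 where c1: "convex_conjugate h p1 = ereal c1"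
    "\<And>q. ereal (c1 + (G (x, y1) - \<alpha> *\<^sub>R p1 + b) \<bullet> (q - p1)) \<le> convex_conjugate h q"
    using subdifferential_real[OF sol(2)[OF 1]] by blast
  obtain c2 where c2: "convex_conjugate h p2 = ereal c2"
    "\<And>q. ereal (c2 + (G (x, y2) - \<alpha> *\<^sub>R p2 + b) \<bullet> (q - p2)) \<le> convex_conjugate h q"
    using subdifferential_real[OF sol(2)[OF 2]] by blast
  have "\<alpha> * ((p1 - p2) \<bullet> (p1 - p2)) + \<beta> * ((y1 - y2) \<bullet> (y1 - y2)) \<le> 0"
    using sol(1)[OF 1, of y2] sol(1)[OF 2, of y1] c1(2)[of p2] c2(2)[of p1] c1(1) c2(1)
    by (simp add: inner_diff_left inner_diff_right inner_add_left inner_add_right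
        inner_commute algebra_simps)
  moreover have "0 \<le> \<alpha> * ((p1 - p2) \<bullet> (p1 - p2))" "0 \<le> \<beta> * ((y1 - y2) \<bullet> (y1 - y2))"
    using pos by auto
  ultimately have "\<alpha> * ((p1 - p2) \<bullet> (p1 - p2)) = 0" "\<beta> * ((y1 - y2) \<bullet> (y1 - y2)) = 0"
    by linarith+
  then show ?thesis using pos by simp
qed

text \<open>The regularization weights are variables of the implicit function theorem and range over
  a neighbourhood of 0, which is why one branch is jointly smooth across the unregularized
  system.\<close>

lemma solution_branch:
  assumes sol: "(y0, p0) \<in> sol g G h x0"
    and ri: "G (x0, y0) \<in> rel_interior (subdifferential (convex_conjugate h) p0)"
    and second_order:
      "\<And>w z. z \<in> critical_cone (convex_conjugate h) p0 (G (x0, y0)) \<Longrightarrow>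
              - (transpose (jac_y G x0 y0) *v z) = hess_yy_lagrangian g G h x0 y0 p0 *v w \<Longrightarrow>
              - (jac_y G x0 y0 *v w)
                \<in> (critical_cone (convex_conjugate h) p0 (G (x0, y0)))\<^sup>\<bottom> \<Longrightarrow>
              w = 0 \<and> z = 0"
  obtains W \<sigma> where "open W" "(x0, 0, 0, 0, 0) \<in> W" "\<sigma> (x0, 0, 0, 0, 0) = (y0, p0)"
    "C1_on W \<sigma>" "\<And>t. t \<in> W \<Longrightarrow> \<sigma> t \<in> perturbed_sol g G h t"
proof -
  let ?ubar = "G (x0, y0)"
  obtain S \<delta> where S: "subspace S" and K: "critical_cone (convex_conjugate h) p0 ?ubar = S\<^sup>\<bottom>"
    and \<delta>: "\<delta> > 0"
    and graph: "\<And>p u. \<lbrakk>p - p0 \<in> S\<^sup>\<bottom>; norm (p - p0) < \<delta>; u - ?ubar \<in> S; norm (u - ?ubar) < \<delta>\<rbrakk>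
         \<Longrightarrow> u \<in> subdifferential (convex_conjugate h) p"
    using subdifferential_conjugate_rel_interior[OF h_proper h_epi_polyhedral ri] by blast
  obtain Q where Q: "bounded_linear Q" "\<And>v. Q v \<in> S" "\<And>v. v - Q v \<in> S\<^sup>\<bottom>"
    using orthogonal_projection[OF S] by metis
  \<comment> \<open>The two summands lie in the orthogonal subspaces
    \<open>S\<^sup>\<bottom>\<close> and \<open>S\<close>, so both vanish. One equation thus encodes
    both conditions of the affine piece, and the system has as many equations as unknowns.\<close>
  have split: "r \<in> S \<and> v \<in> S\<^sup>\<bottom>" if eq: "(r - Q r) + Q v = 0" for r v
  proof -
    have "orthogonal (Q v) (r - Q r)" using Q(2)[of v] Q(3)[of r] by (simp add: orthogonal_comp_def)
    moreover have "r - Q r = - Q v" using eq by (simp add: eq_neg_iff_add_eq_0)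
    ultimately have "Q v = 0" "r = Q r" by (auto simp: orthogonal_def)
    then show ?thesis using Q(2)[of r] Q(3)[of v] by auto
  qed
  define r :: "((real^'n) \<times> real \<times> real \<times> (real^'m) \<times> (real^'s)) \<times> (real^'m) \<times> (real^'s) \<Rightarrow> real^'s"
    where "r z = G (fst (fst z), fst (snd z)) - fst (snd (fst z)) *\<^sub>R snd (snd z)
      + snd (snd (snd (snd (fst z))))" for z
  define F where "F z =
      (lagrangian_grad (fst (fst z), fst (snd z)) (snd (snd z))
        + fst (snd (snd (fst z))) *\<^sub>R fst (snd z) - fst (snd (snd (snd (fst z)))),
       ((r z - ?ubar) - Q (r z - ?ubar)) + Q (snd (snd z) - p0))" for z
  have G_comp: "C1_on UNIV (\<lambda>z. f (fst (fst z), fst (snd z)))" if "C1_on UNIV f"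
    for f :: "(real^'n) \<times> (real^'m) \<Rightarrow> 'z::real_normed_vector"
    by (rule C1_on_compose[OF that]) (auto intro!: C1_on_intros)
  have r_C1: "C1_on UNIV r"
    unfolding r_def by (intro C1_on_intros G_comp C1)
  have F_C1: "C1_on UNIV F"
    unfolding F_def lagrangian_grad_def
    by (intro C1_on_intros G_comp C1 r_C1 C1_on_linear_compose[OF Q(1)])
  have F_iff: "F ((x, \<alpha>, \<beta>, a, b), (y, p)) = 0 \<longleftrightarrow>
      lagrangian_grad (x, y) p + \<beta> *\<^sub>R y - a = 0 \<and>
      (G (x, y) - \<alpha> *\<^sub>R p + b - ?ubar) - Q (G (x, y) - \<alpha> *\<^sub>R p + b - ?ubar) + Q (p - p0) = 0"
    for x \<alpha> \<beta> a b y p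
    by (simp add: F_def r_def zero_prod_def)
  let ?tbar = "(x0, 0, 0, 0, 0) :: (real^'n) \<times> real \<times> real \<times> (real^'m) \<times> (real^'s)"
  have grad0: "lagrangian_grad (x0, y0) p0 = 0"
    using sol unfolding sol_eq_perturbed_sol perturbed_sol_def lagrangian_grad_eq by simp
  have Q0: "Q 0 = 0" using Q(1) by (simp add: linear_0 bounded_linear.linear)
  have F0: "F (?tbar, (y0, p0)) = 0"
    unfolding F_iff by (simp add: grad0 Q0)
  have fin: "\<bar>convex_conjugate h p0\<bar> \<noteq> \<infinity>"
    using subsetD[OF rel_interior_subset ri] by (simp add: subdifferential_def)
  \<comment> \<open>At \<open>?tbar\<close> the regularization and shift terms vanish; what remains
    is expressed by the Hessian and Jacobian of the second-order condition.\<close>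
  have F': "total_deriv F (?tbar, (y0, p0)) (0, (w, q)) =
      (hess_yy_lagrangian g G h x0 y0 p0 *v w + transpose (jac_y G x0 y0) *v q,
       (jac_y G x0 y0 *v w - Q (jac_y G x0 y0 *v w)) + Q q)" for w q
  proof -
    have sec: "((\<lambda>v. f (x0, fst v)) has_derivative (\<lambda>v. total_deriv f (x0, y0) (0, fst v))) (at (y0, p0))"
      if "f differentiable at (x0, y0)"
      for f :: "(real^'n) \<times> (real^'m) \<Rightarrow> 'z::real_normed_vector"
      using diff_chain_at[OF bounded_linear_imp_has_derivative[OF bounded_linear_fst]
          , of "\<lambda>y. f (x0, y)" _ "(y0, p0)"] has_derivative_section[OF that]
      by (simp add: o_def)
    have "((\<lambda>v. F (?tbar, v)) has_derivative (\<lambda>v.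
        (partial_adjoint (total_deriv (total_deriv g) (x0, y0) (0, fst v)) 1
          + (partial_adjoint (total_deriv G (x0, y0)) (snd v)
            + partial_adjoint (total_deriv (total_deriv G) (x0, y0) (0, fst v)) p0),
         (total_deriv G (x0, y0) (0, fst v) - Q (total_deriv G (x0, y0) (0, fst v)))
          + Q (snd v)))) (at (y0, p0))"
    proof -
      have F_sec: "F (?tbar, v) =
        (partial_adjoint (total_deriv g (x0, fst v)) 1 + partial_adjoint (total_deriv G (x0, fst v)) (snd v),
         ((G (x0, fst v) - ?ubar) - Q (G (x0, fst v) - ?ubar)) + Q (snd v - p0))" for v
        by (simp add: F_def r_def lagrangian_grad_def)
      have G': "((\<lambda>v. G (x0, fst v) - ?ubar) has_derivative (\<lambda>v. total_deriv G (x0, y0) (0, fst v))) (at (y0, p0))"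
        using has_derivative_diff[OF sec[OF differentiable(2)] has_derivative_const] by simp
      have snd': "((\<lambda>v. snd v - p0) has_derivative snd) (at (y0, p0))"
        using has_derivative_diff[OF bounded_linear_imp_has_derivative[OF bounded_linear_snd] has_derivative_const]
        by simp
      have bil: "((\<lambda>v. partial_adjoint (total_deriv G (x0, fst v)) (snd v)) has_derivative
          (\<lambda>v. partial_adjoint (total_deriv G (x0, y0)) (snd v)
            + partial_adjoint (total_deriv (total_deriv G) (x0, y0) (0, fst v)) p0)) (at (y0, p0))"
        using bounded_bilinear.FDERIV[OF bounded_bilinear_partial_adjoint sec[OF differentiable(4)]
            bounded_linear_imp_has_derivative[OF bounded_linear_snd]] by simp
      show ?thesis
        unfolding F_sec
        by (intro has_derivative_Pair has_derivative_add has_derivative_diff bil G' snd'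
            bounded_linear.has_derivative[OF Q(1)] sec differentiable
            bounded_linear.has_derivative[OF bounded_bilinear.bounded_linear_left[OF bounded_bilinear_partial_adjoint]])
    qed
    moreover have "F differentiable at (?tbar, (y0, p0))" using F_C1 by (simp add: C1_on_def)
    ultimately have "(\<lambda>v. total_deriv F (?tbar, (y0, p0)) (0, v)) = (\<lambda>v.
        (partial_adjoint (total_deriv (total_deriv g) (x0, y0) (0, fst v)) 1
          + (partial_adjoint (total_deriv G (x0, y0)) (snd v)
            + partial_adjoint (total_deriv (total_deriv G) (x0, y0) (0, fst v)) p0),
         (total_deriv G (x0, y0) (0, fst v) - Q (total_deriv G (x0, y0) (0, fst v)))
          + Q (snd v)))"
      using has_derivative_unique has_derivative_section by blast
    from fun_cong[OF this, of "(w, q)"] show ?thesis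
      by (simp del: transpose_matrix_vector
          add: hess_yy_lagrangian_mult[OF fin] jac_y_mult[OF differentiable(2)]
          transpose_jac_y_mult[OF differentiable(2)] algebra_simps)
  qed
  \<comment> \<open>By \<open>split\<close>, a kernel element satisfies exactly the premises of the
    second-order condition, with \<open>S\<close> equal to its double orthogonal complement.\<close>
  have inj: "v = 0" if "total_deriv F (?tbar, (y0, p0)) (0, v) = 0" for v
  proof -
    obtain w q where v: "v = (w, q)" by (cases v)
    have eqs: "hess_yy_lagrangian g G h x0 y0 p0 *v w + transpose (jac_y G x0 y0) *v q = 0"
      "(jac_y G x0 y0 *v w - Q (jac_y G x0 y0 *v w)) + Q q = 0"
      using that unfolding v F' by (simp_all add: zero_prod_def)
    have "jac_y G x0 y0 *v w \<in> S" "q \<in> S\<^sup>\<bottom>" using split[OF eqs(2)] by auto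
    then have "- (jac_y G x0 y0 *v w) \<in> S\<^sup>\<bottom>\<^sup>\<bottom>"
      by (simp only: orthogonal_comp_self[OF S] subspace_neg[OF S])
    moreover have "- (transpose (jac_y G x0 y0) *v q) = hess_yy_lagrangian g G h x0 y0 p0 *v w"
      using eqs(1) by (metis add_eq_0_iff2)
    ultimately have "w = 0 \<and> q = 0"
      using second_order[unfolded K] \<open>q \<in> S\<^sup>\<bottom>\<close> by blast
    then show ?thesis by (simp add: v zero_prod_def)
  qed
  obtain W \<sigma> where W: "open W" "?tbar \<in> W" "\<sigma> ?tbar = (y0, p0)" "C1_on W \<sigma>"
    and zero: "\<And>t. t \<in> W \<Longrightarrow> F (t, \<sigma> t) = 0"
    using implicit_function[OF F_C1 F0 inj] by blast
  define \<kappa> where "\<kappa> t = (snd (\<sigma> t) - p0, r (t, \<sigma> t) - ?ubar)" for t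
  \<comment> \<open>The affine space agrees with the graph only near the reference point, so the
    neighbourhood is shrunk until both deviations recorded by \<open>\<kappa>\<close> are below
    \<open>\<delta>\<close>.\<close>
  define W' where "W' = W \<inter> \<kappa> -` (ball 0 \<delta> \<times> ball 0 \<delta>)"
  have "continuous_on W (\<lambda>t. r (t, \<sigma> t))"
    by (rule C1_on_imp_continuous_on[OF C1_on_compose[OF r_C1]]) (auto intro!: C1_on_intros W(4))
  then have "continuous_on W \<kappa>"
    unfolding \<kappa>_def using C1_on_imp_continuous_on[OF W(4)] by (intro continuous_intros)
  then have "open W'"
    unfolding W'_def by (intro continuous_open_preimage W(1) open_Times open_ball)
  moreover have "?tbar \<in> W'"
    using W(2,3) \<delta> by (simp add: W'_def \<kappa>_def r_def)
  moreover have "\<sigma> t \<in> perturbed_sol g G h t" if t: "t \<in> W'" for t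
  proof -
    obtain x \<alpha> \<beta> a b y p where tt: "t = (x, \<alpha>, \<beta>, a, b)" and yp: "\<sigma> t = (y, p)"
      by (metis prod.collapse)
    let ?u = "G (x, y) - \<alpha> *\<^sub>R p + b"
    have small: "norm (p - p0) < \<delta>" "norm (?u - ?ubar) < \<delta>"
      using t yp tt \<delta> by (simp_all add: W'_def \<kappa>_def r_def)
    have "F ((x, \<alpha>, \<beta>, a, b), (y, p)) = 0" using zero[of t] t yp by (simp add: W'_def tt)
    then have grad: "lagrangian_grad (x, y) p + \<beta> *\<^sub>R y - a = 0"
      and "(?u - ?ubar) - Q (?u - ?ubar) + Q (p - p0) = 0"
      unfolding F_iff by blast+
    then have "?u \<in> subdifferential (convex_conjugate h) p"
      using split small by (intro graph) blast+
    then show ?thesis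
      using grad unfolding yp unfolding tt perturbed_sol_def lagrangian_grad_eq by simp
  qed
  ultimately show thesis
    using that[of W' \<sigma>] W(3) C1_on_subset[OF W(4), of W'] by (simp add: W'_def)
qed

section \<open>The branch exhausts the solution sets\<close>

lemma sol_reg_eq_branch:
  assumes "\<sigma> (x, \<alpha>, \<beta>, 0, 0) \<in> perturbed_sol g G h (x, \<alpha>, \<beta>, 0, 0)" and "\<alpha> > 0" "\<beta> > 0"
  shows "sol_reg g G h \<alpha> \<beta> x = {\<sigma> (x, \<alpha>, \<beta>, 0, 0)}"
proof -
  have "q = \<sigma> (x, \<alpha>, \<beta>, 0, 0)" if "q \<in> perturbed_sol g G h (x, \<alpha>, \<beta>, 0, 0)" for q
    using perturbed_sol_unique[OF _ _ assms(2,3)] that assms(1) by (metis prod.collapse)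
  then show ?thesis
    using assms(1) unfolding sol_reg_eq_perturbed_sol by blast
qed

text \<open>The optimality system itself is not strongly monotone. But any solution \<open>(y, p)\<close> also solves the
  system with regularization terms \<open>c (y' - y)\<close> and \<open>c (p' - p)\<close> centred at it, which has no
  other solution, so that \<open>(y, p)\<close> is the value of the branch for every small \<open>c > 0\<close>.\<close>

lemma sol_eq_branch:
  assumes W: "open W" and \<sigma>: "continuous_on W \<sigma>" and x: "(x, 0, 0, 0, 0) \<in> W"
    and branch: "\<And>t. t \<in> W \<Longrightarrow> \<sigma> t \<in> perturbed_sol g G h t"
  shows "sol g G h x = {\<sigma> (x, 0, 0, 0, 0)}"
proof -
  have "(y, p) = \<sigma> (x, 0, 0, 0, 0)" if yp: "(y, p) \<in> sol g G h x" for y p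
  proof -
    \<comment> \<open>With weights \<open>c\<close> and shifts \<open>c y\<close>,
      \<open>c p\<close> the added terms vanish at \<open>(y, p)\<close> itself.\<close>
    define t where "t c = (x, c, c, c *\<^sub>R y, c *\<^sub>R p)" for c
    have sol: "(y, p) \<in> perturbed_sol g G h (t c)" for c
      using yp unfolding sol_eq_perturbed_sol by (simp add: perturbed_sol_def t_def)
    have lim: "(t \<longlongrightarrow> (x, 0, 0, 0, 0)) (at_right 0)"
      unfolding t_def by (auto intro!: tendsto_eq_intros)
    have "\<forall>\<^sub>F c in at_right 0. t c \<in> W"
      by (rule topological_tendstoD[OF lim W x])
    moreover have "\<forall>\<^sub>F c in at_right 0. c > (0::real)"
      by (rule eventually_at_right_less)
    ultimately have "\<forall>\<^sub>F c in at_right 0. \<sigma> (t c) = (y, p)"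
    proof eventually_elim
      case (elim c)
      then have "\<sigma> (t c) \<in> perturbed_sol g G h (t c)" by (intro branch)
      then show ?case
        using perturbed_sol_unique[OF _ sol[of c, unfolded t_def]] elim(2)
        by (metis prod.collapse t_def)
    qed
    then have "((\<lambda>c. \<sigma> (t c)) \<longlongrightarrow> (y, p)) (at_right 0)"
      by (rule tendsto_eventually)
    moreover have "((\<lambda>c. \<sigma> (t c)) \<longlongrightarrow> \<sigma> (x, 0, 0, 0, 0)) (at_right 0)"
      using \<sigma> W x by (intro isCont_tendsto_compose[OF _ lim]) (simp add: continuous_on_eq_continuous_at)
    ultimately show ?thesis
      by (intro tendsto_unique[OF trivial_limit_at_right_real])
  qed
  moreover have "\<sigma> (x, 0, 0, 0, 0) \<in> sol g G h x"
    using branch[OF x] by (simp only: sol_eq_perturbed_sol)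
  ultimately show ?thesis by auto
qed

end

section \<open>Convergence of the regularized solutions and of their derivatives\<close>

theorem proposition4p2:
  fixes g :: "(real^'n) \<times> (real^'m) \<Rightarrow> real"
    and G :: "(real^'n) \<times> (real^'m) \<Rightarrow> real^'s"
    and h :: "real^'s \<Rightarrow> ereal"
    and x :: "nat \<Rightarrow> real^'n" and xbar :: "real^'n"
    and ybar :: "real^'m" and pbar :: "real^'s"
    and \<alpha> \<beta> :: "nat \<Rightarrow> real"
  assumes g_C2: "C2_on UNIV g"
    and G_C2: "C2_on UNIV G"
    and g_convex: "\<And>x'. convex_on UNIV (\<lambda>y. g (x', y))"
    and G_convex: "\<And>x' i. convex_on UNIV (\<lambda>y. G (x', y) $ i)"
    and h_proper: "proper_fun h"
    and h_epi_polyhedral: "polyhedron (epi h)"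
    and h_nondecreasing: "\<And>z z'. (\<forall>i. z' $ i \<le> z $ i) \<Longrightarrow> h z' \<le> h z"
    and x_lim: "x \<longlonglongrightarrow> xbar"
    and \<alpha>_pos: "\<And>\<nu>. \<alpha> \<nu> > 0" and \<alpha>_lim: "\<alpha> \<longlonglongrightarrow> 0"
    and \<beta>_pos: "\<And>\<nu>. \<beta> \<nu> > 0" and \<beta>_lim: "\<beta> \<longlonglongrightarrow> 0"
    and sol_xbar: "sol g G h xbar = {(ybar, pbar)}"
    and basic_qualification:
      "\<And>u. u \<in> horizon_subdifferential h (G (xbar, ybar)) \<Longrightarrow>
            transpose (jac_y G xbar ybar) *v u = 0 \<Longrightarrow> u = 0"
    and relative_interior:
      "G (xbar, ybar) \<in> rel_interior (subdifferential (convex_conjugate h) pbar)"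
    and second_order:
      "\<And>w z. z \<in> critical_cone (convex_conjugate h) pbar (G (xbar, ybar)) \<Longrightarrow>
              - (transpose (jac_y G xbar ybar) *v z) = hess_yy_lagrangian g G h xbar ybar pbar *v w \<Longrightarrow>
              - (jac_y G xbar ybar *v w)
                \<in> (critical_cone (convex_conjugate h) pbar (G (xbar, ybar)))\<^sup>\<bottom> \<Longrightarrow>
              w = 0 \<and> z = 0"
  shows "(\<lambda>\<nu>. as_fun (sol_reg g G h (\<alpha> \<nu>) (\<beta> \<nu>)) (x \<nu>)) \<longlonglongrightarrow> (ybar, pbar)
    \<and> (\<forall>\<^sub>F \<nu> in sequentially. single_valued_C1_around (sol_reg g G h (\<alpha> \<nu>) (\<beta> \<nu>)) (x \<nu>))
    \<and> single_valued_C1_around (sol g G h) xbar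
    \<and> (\<lambda>\<nu>. total_deriv (as_fun (sol_reg g G h (\<alpha> \<nu>) (\<beta> \<nu>))) (x \<nu>))
         \<longlonglongrightarrow> total_deriv (as_fun (sol g G h)) xbar"
proof -
  interpret composite_problem g G h
    by unfold_locales (fact g_C2 G_C2 g_convex G_convex h_proper h_epi_polyhedral h_nondecreasing)+
  let ?tbar = "(xbar, 0, 0, 0, 0) :: (real^'n) \<times> real \<times> real \<times> (real^'m) \<times> (real^'s)"
  have "(ybar, pbar) \<in> sol g G h xbar" using sol_xbar by simp
  then obtain W \<sigma> where W: "open W" "?tbar \<in> W" and \<sigma>: "\<sigma> ?tbar = (ybar, pbar)" "C1_on W \<sigma>"
    and branch: "\<And>t. t \<in> W \<Longrightarrow> \<sigma> t \<in> perturbed_sol g G h t"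
    using solution_branch[OF _ relative_interior second_order] by blast
  have cont: "continuous_on W \<sigma>" by (rule C1_on_imp_continuous_on[OF \<sigma>(2)])
  define t where "t \<nu> = (x \<nu>, \<alpha> \<nu>, \<beta> \<nu>, 0 :: real^'m, 0 :: real^'s)" for \<nu>
  have t_lim: "t \<longlonglongrightarrow> ?tbar"
    unfolding t_def by (intro tendsto_Pair x_lim \<alpha>_lim \<beta>_lim tendsto_const)
  have t_W: "\<forall>\<^sub>F \<nu> in sequentially. t \<nu> \<in> W"
    by (rule topological_tendstoD[OF t_lim W])
  \<comment> \<open>Valid for every \<open>x'\<close> with parameter tuple in the open set
    \<open>W\<close>, hence on a neighbourhood of \<open>x \<nu>\<close> once \<open>t \<nu>\<close>
    is in \<open>W\<close>.\<close>
  have reg: "sol_reg g G h (\<alpha> \<nu>) (\<beta> \<nu>) x' = {\<sigma> (x', \<alpha> \<nu>, \<beta> \<nu>, 0, 0)}"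
    if "(x', \<alpha> \<nu>, \<beta> \<nu>, 0, 0) \<in> W" for x' \<nu>
    by (rule sol_reg_eq_branch[where \<sigma> = \<sigma>, OF branch[OF that] \<alpha>_pos \<beta>_pos])
  note sec_reg = C1_section[OF W(1) \<sigma>(2) _ reg]
  have sol: "sol g G h x' = {\<sigma> (x', 0, 0, 0, 0)}" if "(x', 0, 0, 0, 0) \<in> W" for x'
    by (rule sol_eq_branch[OF W(1) cont that branch])
  have sec: "single_valued_C1_around (sol g G h) xbar"
    "total_deriv (as_fun (sol g G h)) xbar = total_deriv \<sigma> ?tbar o\<^sub>L Blinfun (\<lambda>x. (x, 0))"
    by (rule C1_section[OF W(1) \<sigma>(2) W(2)], rule sol, assumption)+
  have isCont: "isCont \<sigma> ?tbar" "isCont (total_deriv \<sigma>) ?tbar"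
    using W \<sigma>(2) cont by (simp_all add: C1_on_def continuous_on_eq_continuous_at)
  have "(\<lambda>\<nu>. as_fun (sol_reg g G h (\<alpha> \<nu>) (\<beta> \<nu>)) (x \<nu>)) \<longlonglongrightarrow> (ybar, pbar)"
  proof (rule Lim_transform_eventually)
    show "(\<lambda>\<nu>. \<sigma> (t \<nu>)) \<longlonglongrightarrow> (ybar, pbar)"
      using isCont_tendsto_compose[OF isCont(1) t_lim] by (simp add: \<sigma>(1))
    show "\<forall>\<^sub>F \<nu> in sequentially. \<sigma> (t \<nu>) = as_fun (sol_reg g G h (\<alpha> \<nu>) (\<beta> \<nu>)) (x \<nu>)"
      using t_W by eventually_elim (simp add: t_def as_fun_def reg)
  qed
  moreover have "\<forall>\<^sub>F \<nu> in sequentially. single_valued_C1_around (sol_reg g G h (\<alpha> \<nu>) (\<beta> \<nu>)) (x \<nu>)"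
    using t_W by eventually_elim (auto simp: t_def intro: sec_reg(1))
  moreover have "(\<lambda>\<nu>. total_deriv (as_fun (sol_reg g G h (\<alpha> \<nu>) (\<beta> \<nu>))) (x \<nu>))
      \<longlonglongrightarrow> total_deriv (as_fun (sol g G h)) xbar"
  \<comment> \<open>Both derivatives are \<open>total_deriv \<sigma>\<close>, at
    \<open>t \<nu>\<close> and at \<open>?tbar\<close>, composed with the same embedding, so the
    limit is continuity of \<open>total_deriv \<sigma>\<close>.\<close>
  proof (rule Lim_transform_eventually)
    show "(\<lambda>\<nu>. total_deriv \<sigma> (t \<nu>) o\<^sub>L Blinfun (\<lambda>x. (x, 0)))
        \<longlonglongrightarrow> total_deriv (as_fun (sol g G h)) xbar"
      unfolding sec(2)
      by (rule bounded_bilinear.tendsto[OF bounded_bilinear_blinfun_compose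
            isCont_tendsto_compose[OF isCont(2) t_lim] tendsto_const])
    show "\<forall>\<^sub>F \<nu> in sequentially. total_deriv \<sigma> (t \<nu>) o\<^sub>L Blinfun (\<lambda>x. (x, 0))
        = total_deriv (as_fun (sol_reg g G h (\<alpha> \<nu>) (\<beta> \<nu>))) (x \<nu>)"
      using t_W by eventually_elim (simp add: t_def sec_reg(2))
  qed
  ultimately show ?thesis using sec(1) by blast
qed

end
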